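(* Let $\xi=(\omega,\gamma,\mu,c)$ be a normalized quasi-abelian 3-cocycle on a finite crossed module $(G,X,\partial)$, and let $R$ be a complete set of representatives of the orbits of $G$ on $X$. For $a\in R$ let $\phi_a(g,h)=\gamma_{g,h}(a)$ for $g,h\in\mathrm{Stab}_G(a)=\{g\in G\mid {}^ga=a\}$ (a 2-cocycle on $\mathrm{Stab}_G(a)$). Then the set of isomorphism classes of simple objects of $\mathcal{C}(\xi)^G$ is in bijection with the set of isomorphism classes of $$\Gamma=\{(a,V)\mid a\in R,\ V \text{ an irreducible module over } \mathbb{K}_{\phi_a}[\mathrm{Stab}_G(a)]\},$$ where $(a,V)$ and $(a',V')$ are isomorphic if $a=a'$ and $V\cong V'$.
   Context: $\mathbb{K}$ is an algebraically closed field of characteristic $0$. A module over the twisted group algebra $\mathbb{K}_{\phi}[H]$ (for a 2-cocycle $\phi$ on a finite group $H$) means, as used here, a finite-dimensional vector space $V$ with linear maps $v\mapsto t\triangleright v$ ($t\in H$) such that $st\triangleright v=\phi(s,t)\,(s\triangleright(t\triangleright v))$ and $e\triangleright v=v$. A finite crossed module is a triple $(G,X,\partial)$ with $G,X$ finite groups, $G$ acting on $X$ by automorphisms $(g,x)\mapsto {}^{g}x$, and $\partial:X\to G$ a homomorphism with ${}^{\partial(x)}x'=xx'x^{-1}$ and $\partial({}^gx)=g\partial(x)g^{-1}$. A quasi-abelian 3-cocycle on it is a quadruple $\xi=(\omega,\gamma,\mu,c)$ of functions $\omega:X^3\to\mathbb{K}^\times$, $(g,h,x)\mapsto\gamma_{g,h}(x)$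 on $G\times G\times X$, $(g,x,y)\mapsto\mu_g(x,y)$ on $G\times X\times X$, $c:X^2\to\mathbb{K}^\times$, such that for all $g,h,k\in G$, $w,x,y,z\in X$: (a) $\omega(x,y,z)\omega(w,xy,z)\omega(w,x,y)=\omega(w,x,yz)\omega(wx,y,z)$; (b) $\gamma_{h,k}(x)\gamma_{g,hk}(x)=\gamma_{gh,k}(x)\gamma_{g,h}({}^kx)$; (c) $\frac{\mu_g(y,z)\mu_g(x,yz)}{\mu_g(xy,z)\mu_g(x,y)}=\frac{\omega({}^gx,{}^gy,{}^gz)}{\omega(x,y,z)}$; (d) $\frac{\gamma_{g,h}(x)\gamma_{g,h}(y)}{\gamma_{g,h}(xy)}=\frac{\mu_g({}^hx,{}^hy)\mu_h(x,y)}{\mu_{gh}(x,y)}$; (e) $\frac{c({}^gx,{}^gy)}{c(x,y)}=\frac{\mu_g(xyx^{-1},x)}{\mu_g(x,y)}\cdot\frac{\gamma_{g\partial(x)g^{-1},g}(y)}{\gamma_{g,\partial(x)}(y)}$; (f) $c(xy,z)=\frac{\omega(x,y,z)\,\omega((xy)z(xy)^{-1},x,y)}{\omega(x,yzy^{-1},y)\,\gamma_{\partial(x),\partial(y)}(z)}\,c(x,yzy^{-1})\,c(y,z)$; (g) $c(x,yz)=\frac{\omega(xyx^{-1},x,z)}{\omega(x,y,z)\,\omega(xyx^{-1},xzx^{-1},x)\,\mu_{\partial(x)}(y,z)}\,c(x,y)\,c(x,z)$. It is normalized if $\omega(x,y,z)=1$ whenever one of $x,y,z$ is $e$, $\gamma_{g,h}(x)=1$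 whenever one of $g,h,x$ is $e$, $\mu_g(x,y)=1$ whenever one of $g,x,y$ is $e$, and $c(x,y)=1$ whenever $x$ or $y$ is $e$. $\mathcal{C}(\xi)$ denotes the fusion category $\mathrm{Vec}_X^\omega$ of finite-dimensional $X$-graded vector spaces (tensor product $\otimes_\mathbb{K}$ with degrees multiplied, associativity $(u\otimes v)\otimes w\mapsto\omega(x,y,z)u\otimes(v\otimes w)$) with: the $G$-grading with $\mathcal{C}_g$ the objects supported on $\partial^{-1}(g)$; functors $T_g$ sending homogeneous $V$ of degree $x$ to the same space in degree ${}^gx$; and for homogeneous $V,W$ of degrees $x,y$ the isomorphisms $\tilde\gamma_{g,h}(V)=\gamma_{g,h}(x)\mathrm{id}_V:T_{gh}(V)\to T_gT_h(V)$, $\tilde\mu_g(V,W)=\mu_g(x,y)\mathrm{id}:T_g(V\otimes W)\to T_gV\otimes T_gW$, $\tilde c(V,W)=c(x,y)\tau_{V,W}:V\otimes W\to T_{\partial(x)}(W)\otimes V$ ($\tau$ the flip). The equivariantization $\mathcal{C}(\xi)^G$ is the braided fusion category of pairs $(V,\{u_g\}_{g\in G})$, $u_g:T_g(V)\to V$ isomorphisms with $u_{gh}=u_g\circ T_g(u_h)\circ\tilde\gamma_{g,h}(V)$; morphisms are morphisms of $\mathrm{Vec}_X^\omega$ commuting with the $u_g$; tensor product $(V\otimes V',\{(u_g\otimes u'_g)\circ\tilde\mu_g(V,V')\})$; braiding given on $V_g\otimes V'$ ($V_g$ the component of $V$ in $\mathcal{C}_g$) by $(u'_g\otimes\mathrm{id})\circ\tilde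 c(V_g,V')$. *)

theory Defs
  imports "Jordan_Normal_Form.Matrix" "HOL-Algebra.Group"
    "HOL-Computational_Algebra.Polynomial"
begin

section \<open>Ground field\<close>

definition alg_closed :: "'k::field itself \<Rightarrow> bool" where
  "alg_closed _ \<longleftrightarrow> (\<forall>p :: 'k poly. degree p \<ge> 1 \<longrightarrow> (\<exists>z. poly p z = 0))"

section \<open>Finite crossed modules\<close>

text \<open>act g x is the action g . x of G on X; bd is the boundary map.\<close>

definition crossed_module ::
  "('g, 'a) monoid_scheme \<Rightarrow> ('x, 'b) monoid_scheme \<Rightarrow> ('g \<Rightarrow> 'x \<Rightarrow> 'x) \<Rightarrow> ('x \<Rightarrow> 'g) \<Rightarrow> bool" where
  "crossed_module G X act bd \<longleftrightarrow>
     group G \<and> group X \<and> finite (carrier G) \<and> finite (carrier X) \<and>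
     (\<forall>g\<in>carrier G. act g \<in> hom X X \<and> bij_betw (act g) (carrier X) (carrier X)) \<and>
     (\<forall>x\<in>carrier X. act \<one>\<^bsub>G\<^esub> x = x) \<and>
     (\<forall>g\<in>carrier G. \<forall>h\<in>carrier G. \<forall>x\<in>carrier X.
        act (g \<otimes>\<^bsub>G\<^esub> h) x = act g (act h x)) \<and>
     bd \<in> hom X G \<and>
     (\<forall>x\<in>carrier X. \<forall>x'\<in>carrier X.
        act (bd x) x' = x \<otimes>\<^bsub>X\<^esub> x' \<otimes>\<^bsub>X\<^esub> inv\<^bsub>X\<^esub> x) \<and>
     (\<forall>g\<in>carrier G. \<forall>x\<in>carrier X.
        bd (act g x) = g \<otimes>\<^bsub>G\<^esub> bd x \<otimes>\<^bsub>G\<^esub> inv\<^bsub>G\<^esub> g)"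

section \<open>Quasi-abelian 3-cocycles\<close>

definition quasi_abelian_3cocycle ::
  "('g, 'a) monoid_scheme \<Rightarrow> ('x, 'b) monoid_scheme \<Rightarrow> ('g \<Rightarrow> 'x \<Rightarrow> 'x) \<Rightarrow> ('x \<Rightarrow> 'g) \<Rightarrow>
   ('x \<Rightarrow> 'x \<Rightarrow> 'x \<Rightarrow> 'k::field) \<Rightarrow> ('g \<Rightarrow> 'g \<Rightarrow> 'x \<Rightarrow> 'k) \<Rightarrow>
   ('g \<Rightarrow> 'x \<Rightarrow> 'x \<Rightarrow> 'k) \<Rightarrow> ('x \<Rightarrow> 'x \<Rightarrow> 'k) \<Rightarrow> bool" where
  "quasi_abelian_3cocycle G X act bd \<omega> \<gamma> \<mu> c \<longleftrightarrow>
   (let mG = (\<lambda>a b. a \<otimes>\<^bsub>G\<^esub> b); mX = (\<lambda>a b. a \<otimes>\<^bsub>X\<^esub> b);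
        iG = (\<lambda>a. inv\<^bsub>G\<^esub> a); iX = (\<lambda>a. inv\<^bsub>X\<^esub> a) in
   \<comment> \<open>values lie in the multiplicative group of the field\<close>
   (\<forall>x\<in>carrier X. \<forall>y\<in>carrier X. \<forall>z\<in>carrier X. \<omega> x y z \<noteq> 0) \<and>
   (\<forall>g\<in>carrier G. \<forall>h\<in>carrier G. \<forall>x\<in>carrier X. \<gamma> g h x \<noteq> 0) \<and>
   (\<forall>g\<in>carrier G. \<forall>x\<in>carrier X. \<forall>y\<in>carrier X. \<mu> g x y \<noteq> 0) \<and>
   (\<forall>x\<in>carrier X. \<forall>y\<in>carrier X. c x y \<noteq> 0) \<and>
   \<comment> \<open>(a)\<close>
   (\<forall>w\<in>carrier X. \<forall>x\<in>carrier X. \<forall>y\<in>carrier X. \<forall>z\<in>carrier X.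
      \<omega> x y z * \<omega> w (mX x y) z * \<omega> w x y = \<omega> w x (mX y z) * \<omega> (mX w x) y z) \<and>
   \<comment> \<open>(b)\<close>
   (\<forall>g\<in>carrier G. \<forall>h\<in>carrier G. \<forall>k\<in>carrier G. \<forall>x\<in>carrier X.
      \<gamma> h k x * \<gamma> g (mG h k) x = \<gamma> (mG g h) k x * \<gamma> g h (act k x)) \<and>
   \<comment> \<open>(c)\<close>
   (\<forall>g\<in>carrier G. \<forall>x\<in>carrier X. \<forall>y\<in>carrier X. \<forall>z\<in>carrier X.
      (\<mu> g y z * \<mu> g x (mX y z)) / (\<mu> g (mX x y) z * \<mu> g x y)
        = \<omega> (act g x) (act g y) (act g z) / \<omega> x y z) \<and>
   \<comment> \<open>(d)\<close>
   (\<forall>g\<in>carrier G. \<forall>h\<in>carrier G. \<forall>x\<in>carrier X. \<forall>y\<in>carrier X.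
      (\<gamma> g h x * \<gamma> g h y) / \<gamma> g h (mX x y)
        = (\<mu> g (act h x) (act h y) * \<mu> h x y) / \<mu> (mG g h) x y) \<and>
   \<comment> \<open>(e)\<close>
   (\<forall>g\<in>carrier G. \<forall>x\<in>carrier X. \<forall>y\<in>carrier X.
      c (act g x) (act g y) / c x y
        = (\<mu> g (mX (mX x y) (iX x)) x / \<mu> g x y) *
          (\<gamma> (mG (mG g (bd x)) (iG g)) g y / \<gamma> g (bd x) y)) \<and>
   \<comment> \<open>(f)\<close>
   (\<forall>x\<in>carrier X. \<forall>y\<in>carrier X. \<forall>z\<in>carrier X.
      c (mX x y) z
        = (\<omega> x y z * \<omega> (mX (mX (mX x y) z) (iX (mX x y))) x y)
          / (\<omega> x (mX (mX y z) (iX y)) y * \<gamma> (bd x) (bd y) z)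
          * c x (mX (mX y z) (iX y)) * c y z) \<and>
   \<comment> \<open>(g)\<close>
   (\<forall>x\<in>carrier X. \<forall>y\<in>carrier X. \<forall>z\<in>carrier X.
      c x (mX y z)
        = \<omega> (mX (mX x y) (iX x)) x z
          / (\<omega> x y z * \<omega> (mX (mX x y) (iX x)) (mX (mX x z) (iX x)) x * \<mu> (bd x) y z)
          * c x y * c x z))"

definition normalized_cocycle ::
  "('g, 'a) monoid_scheme \<Rightarrow> ('x, 'b) monoid_scheme \<Rightarrow>
   ('x \<Rightarrow> 'x \<Rightarrow> 'x \<Rightarrow> 'k::field) \<Rightarrow> ('g \<Rightarrow> 'g \<Rightarrow> 'x \<Rightarrow> 'k) \<Rightarrow>
   ('g \<Rightarrow> 'x \<Rightarrow> 'x \<Rightarrow> 'k) \<Rightarrow> ('x \<Rightarrow> 'x \<Rightarrow> 'k) \<Rightarrow> bool" where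
  "normalized_cocycle G X \<omega> \<gamma> \<mu> c \<longleftrightarrow>
   (\<forall>x\<in>carrier X. \<forall>y\<in>carrier X. \<forall>z\<in>carrier X.
      (x = \<one>\<^bsub>X\<^esub> \<or> y = \<one>\<^bsub>X\<^esub> \<or> z = \<one>\<^bsub>X\<^esub>) \<longrightarrow> \<omega> x y z = 1) \<and>
   (\<forall>g\<in>carrier G. \<forall>h\<in>carrier G. \<forall>x\<in>carrier X.
      (g = \<one>\<^bsub>G\<^esub> \<or> h = \<one>\<^bsub>G\<^esub> \<or> x = \<one>\<^bsub>X\<^esub>) \<longrightarrow> \<gamma> g h x = 1) \<and>
   (\<forall>g\<in>carrier G. \<forall>x\<in>carrier X. \<forall>y\<in>carrier X.
      (g = \<one>\<^bsub>G\<^esub> \<or> x = \<one>\<^bsub>X\<^esub> \<or> y = \<one>\<^bsub>X\<^esub>) \<longrightarrow> \<mu> g x y = 1) \<and>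
   (\<forall>x\<in>carrier X. \<forall>y\<in>carrier X.
      (x = \<one>\<^bsub>X\<^esub> \<or> y = \<one>\<^bsub>X\<^esub>) \<longrightarrow> c x y = 1)"

section \<open>The equivariantization C(xi)^G: objects, morphisms, simple objects\<close>

text \<open>An X-graded finite-dimensional vector space V is given by the dimensions d x of
  its homogeneous components V_x = K^(d x).  The isomorphism u_g : T_g(V) \<rightarrow> V is given by
  its components u g x : V_x \<rightarrow> V_(g.x) (as matrices).  The condition
  u_gh = u_g \<circ> T_g(u_h) \<circ> \<gamma>~_(g,h)(V) reads componentwise
  u (gh) x = \<gamma> g h x \<cdot> (u g (h.x) * u h x).\<close>

type_synonym ('x, 'g, 'k) eq_obj = "('x \<Rightarrow> nat) \<times> ('g \<Rightarrow> 'x \<Rightarrow> 'k mat)"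

definition eq_object ::
  "('g, 'a) monoid_scheme \<Rightarrow> ('x, 'b) monoid_scheme \<Rightarrow> ('g \<Rightarrow> 'x \<Rightarrow> 'x) \<Rightarrow>
   ('g \<Rightarrow> 'g \<Rightarrow> 'x \<Rightarrow> 'k::field) \<Rightarrow> ('x, 'g, 'k) eq_obj \<Rightarrow> bool" where
  "eq_object G X act \<gamma> V \<longleftrightarrow>
   (let d = fst V; u = snd V in
   (\<forall>g\<in>carrier G. \<forall>x\<in>carrier X.
      u g x \<in> carrier_mat (d (act g x)) (d x) \<and>
      (\<exists>v. v \<in> carrier_mat (d x) (d (act g x)) \<and>
           v * u g x = 1\<^sub>m (d x) \<and> u g x * v = 1\<^sub>m (d (act g x)))) \<and>
   (\<forall>g\<in>carrier G. \<forall>h\<in>carrier G. \<forall>x\<in>carrier X.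
      u (g \<otimes>\<^bsub>G\<^esub> h) x = \<gamma> g h x \<cdot>\<^sub>m (u g (act h x) * u h x)))"

definition eq_morphism ::
  "('g, 'a) monoid_scheme \<Rightarrow> ('x, 'b) monoid_scheme \<Rightarrow> ('g \<Rightarrow> 'x \<Rightarrow> 'x) \<Rightarrow>
   ('x \<Rightarrow> 'k::field mat) \<Rightarrow> ('x, 'g, 'k) eq_obj \<Rightarrow> ('x, 'g, 'k) eq_obj \<Rightarrow> bool" where
  "eq_morphism G X act f V W \<longleftrightarrow>
   (\<forall>x\<in>carrier X. f x \<in> carrier_mat (fst W x) (fst V x)) \<and>
   (\<forall>g\<in>carrier G. \<forall>x\<in>carrier X. f (act g x) * snd V g x = snd W g x * f x)"

definition eq_isomorphic ::
  "('g, 'a) monoid_scheme \<Rightarrow> ('x, 'b) monoid_scheme \<Rightarrow> ('g \<Rightarrow> 'x \<Rightarrow> 'x) \<Rightarrow>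
   ('x, 'g, 'k::field) eq_obj \<Rightarrow> ('x, 'g, 'k) eq_obj \<Rightarrow> bool" where
  "eq_isomorphic G X act V W \<longleftrightarrow>
   (\<exists>f f'. eq_morphism G X act f V W \<and> eq_morphism G X act f' W V \<and>
      (\<forall>x\<in>carrier X. f' x * f x = 1\<^sub>m (fst V x) \<and> f x * f' x = 1\<^sub>m (fst W x)))"

text \<open>Subobjects of (V,u): X-graded subspaces W_x \<subseteq> V_x stable under all u_g.\<close>

definition lin_subspace :: "nat \<Rightarrow> 'k::field vec set \<Rightarrow> bool" where
  "lin_subspace n S \<longleftrightarrow> S \<subseteq> carrier_vec n \<and> 0\<^sub>v n \<in> S \<and>
     (\<forall>v\<in>S. \<forall>w\<in>S. v + w \<in> S) \<and> (\<forall>a. \<forall>v\<in>S. a \<cdot>\<^sub>v v \<in> S)"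

definition eq_subobject ::
  "('g, 'a) monoid_scheme \<Rightarrow> ('x, 'b) monoid_scheme \<Rightarrow> ('g \<Rightarrow> 'x \<Rightarrow> 'x) \<Rightarrow>
   ('x, 'g, 'k::field) eq_obj \<Rightarrow> ('x \<Rightarrow> 'k vec set) \<Rightarrow> bool" where
  "eq_subobject G X act V W \<longleftrightarrow>
   (\<forall>x\<in>carrier X. lin_subspace (fst V x) (W x)) \<and>
   (\<forall>g\<in>carrier G. \<forall>x\<in>carrier X. \<forall>w\<in>W x. snd V g x *\<^sub>v w \<in> W (act g x))"

definition eq_simple ::
  "('g, 'a) monoid_scheme \<Rightarrow> ('x, 'b) monoid_scheme \<Rightarrow> ('g \<Rightarrow> 'x \<Rightarrow> 'x) \<Rightarrow>
   ('g \<Rightarrow> 'g \<Rightarrow> 'x \<Rightarrow> 'k::field) \<Rightarrow> ('x, 'g, 'k) eq_obj \<Rightarrow> bool" where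
  "eq_simple G X act \<gamma> V \<longleftrightarrow>
   eq_object G X act \<gamma> V \<and>
   (\<exists>x\<in>carrier X. fst V x \<noteq> 0) \<and>
   (\<forall>W. eq_subobject G X act V W \<longrightarrow>
      (\<forall>x\<in>carrier X. W x = {0\<^sub>v (fst V x)}) \<or> (\<forall>x\<in>carrier X. W x = carrier_vec (fst V x)))"

definition simple_classes ::
  "('g, 'a) monoid_scheme \<Rightarrow> ('x, 'b) monoid_scheme \<Rightarrow> ('g \<Rightarrow> 'x \<Rightarrow> 'x) \<Rightarrow>
   ('g \<Rightarrow> 'g \<Rightarrow> 'x \<Rightarrow> 'k::field) \<Rightarrow> ('x, 'g, 'k) eq_obj set set" where
  "simple_classes G X act \<gamma> =
     {V. eq_simple G X act \<gamma> V} //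
     {(V, W). eq_simple G X act \<gamma> V \<and> eq_simple G X act \<gamma> W \<and> eq_isomorphic G X act V W}"

section \<open>Modules over twisted group algebras\<close>

text \<open>A module over K_phi[H] of dimension n: matrices rho t (t \<in> H) with
  rho (s t) = phi s t \<cdot> rho s * rho t and rho e = id.\<close>

definition tw_module ::
  "('g, 'a) monoid_scheme \<Rightarrow> 'g set \<Rightarrow> ('g \<Rightarrow> 'g \<Rightarrow> 'k::field) \<Rightarrow> nat \<Rightarrow> ('g \<Rightarrow> 'k mat) \<Rightarrow> bool" where
  "tw_module G H \<phi> n \<rho> \<longleftrightarrow>
   (\<forall>t\<in>H. \<rho> t \<in> carrier_mat n n) \<and>
   (\<forall>s\<in>H. \<forall>t\<in>H. \<rho> (s \<otimes>\<^bsub>G\<^esub> t) = \<phi> s t \<cdot>\<^sub>m (\<rho> s * \<rho> t)) \<and>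
   \<rho> \<one>\<^bsub>G\<^esub> = 1\<^sub>m n"

definition tw_irreducible ::
  "('g, 'a) monoid_scheme \<Rightarrow> 'g set \<Rightarrow> ('g \<Rightarrow> 'g \<Rightarrow> 'k::field) \<Rightarrow> nat \<Rightarrow> ('g \<Rightarrow> 'k mat) \<Rightarrow> bool" where
  "tw_irreducible G H \<phi> n \<rho> \<longleftrightarrow>
   tw_module G H \<phi> n \<rho> \<and> n \<noteq> 0 \<and>
   (\<forall>S. lin_subspace n S \<and> (\<forall>t\<in>H. \<forall>v\<in>S. \<rho> t *\<^sub>v v \<in> S) \<longrightarrow>
      S = {0\<^sub>v n} \<or> S = carrier_vec n)"

definition tw_isomorphic ::
  "'g set \<Rightarrow> nat \<Rightarrow> ('g \<Rightarrow> 'k::field mat) \<Rightarrow> nat \<Rightarrow> ('g \<Rightarrow> 'k mat) \<Rightarrow> bool" where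
  "tw_isomorphic H n \<rho> n' \<rho>' \<longleftrightarrow>
   (\<exists>P Q. P \<in> carrier_mat n' n \<and> Q \<in> carrier_mat n n' \<and>
      Q * P = 1\<^sub>m n \<and> P * Q = 1\<^sub>m n' \<and> (\<forall>t\<in>H. P * \<rho> t = \<rho>' t * P))"

definition stabilizer ::
  "('g, 'a) monoid_scheme \<Rightarrow> ('g \<Rightarrow> 'x \<Rightarrow> 'x) \<Rightarrow> 'x \<Rightarrow> 'g set" where
  "stabilizer G act a = {g \<in> carrier G. act g a = a}"

definition orbit_representatives ::
  "('g, 'a) monoid_scheme \<Rightarrow> ('x, 'b) monoid_scheme \<Rightarrow> ('g \<Rightarrow> 'x \<Rightarrow> 'x) \<Rightarrow> 'x set \<Rightarrow> bool" where
  "orbit_representatives G X act R \<longleftrightarrow>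
   R \<subseteq> carrier X \<and>
   (\<forall>x\<in>carrier X. \<exists>a\<in>R. \<exists>g\<in>carrier G. act g a = x) \<and>
   (\<forall>a\<in>R. \<forall>b\<in>R. (\<exists>g\<in>carrier G. act g a = b) \<longrightarrow> a = b)"

text \<open>Gamma = {(a, V) | a \<in> R, V irreducible over K_(phi_a)[Stab_G(a)]},
  phi_a g h = \<gamma> g h a; a module V is encoded as (n, rho).\<close>

definition Gamma_set ::
  "('g, 'a) monoid_scheme \<Rightarrow> ('g \<Rightarrow> 'x \<Rightarrow> 'x) \<Rightarrow> ('g \<Rightarrow> 'g \<Rightarrow> 'x \<Rightarrow> 'k::field) \<Rightarrow> 'x set \<Rightarrow>
   ('x \<times> nat \<times> ('g \<Rightarrow> 'k mat)) set" where
  "Gamma_set G act \<gamma> R =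
     {(a, n, \<rho>). a \<in> R \<and> tw_irreducible G (stabilizer G act a) (\<lambda>g h. \<gamma> g h a) n \<rho>}"

definition Gamma_classes ::
  "('g, 'a) monoid_scheme \<Rightarrow> ('g \<Rightarrow> 'x \<Rightarrow> 'x) \<Rightarrow> ('g \<Rightarrow> 'g \<Rightarrow> 'x \<Rightarrow> 'k::field) \<Rightarrow> 'x set \<Rightarrow>
   ('x \<times> nat \<times> ('g \<Rightarrow> 'k mat)) set set" where
  "Gamma_classes G act \<gamma> R =
     Gamma_set G act \<gamma> R //
     {((a, n, \<rho>), (a', n', \<rho>')).
        (a, n, \<rho>) \<in> Gamma_set G act \<gamma> R \<and> (a', n', \<rho>') \<in> Gamma_set G act \<gamma> R \<and>
        a = a' \<and> tw_isomorphic (stabilizer G act a) n \<rho> n' \<rho>'}"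

end

theory Submission
  imports Defs "Jordan_Normal_Form.Determinant"
begin

text \<open>A simple object of \<open>\<C>(\<xi>)\<^sup>G\<close> is supported on a single orbit \<open>G\<cdot>a\<close>, and its fibre at \<open>a\<close>,
  acted on by the \<open>u\<^sub>t\<close> with \<open>t \<in> Stab\<^sub>G(a)\<close>, is an irreducible projective representation of the
  stabilizer with cocycle \<open>\<gamma>(-,-,a)\<close>. Conversely such a representation \<open>\<rho>\<close> induces an equivariant
  object: choosing \<open>r\<^sub>x\<close> with \<open>r\<^sub>x\<cdot>a = x\<close> (\<open>orbit_rep\<close>) one has \<open>g r\<^sub>x = r\<^sub>g\<^sub>x h(g,x)\<close> with
  \<open>h(g,x)\<close> (\<open>stab_part\<close>) in the stabilizer, and \<open>u\<^sub>g\<close> acts from the fibre at \<open>x\<close> to the one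
  at \<open>g\<cdot>x\<close> by \<open>\<lambda>(g,x) \<rho>(h(g,x))\<close>, the scalar \<open>\<lambda>\<close> (\<open>ind_factor\<close>) being forced by the
  cocycle identity (b). Restriction and induction are mutually inverse up to isomorphism, and
  induced objects can only be isomorphic if their base points lie in one orbit. Only the action
  and identity (b) with its normalisation are used.\<close>

section \<open>Matrices and subspaces\<close>

lemma smult_smult_mat: "a \<cdot>\<^sub>m (b \<cdot>\<^sub>m (A :: 'a::semigroup_mult mat)) = (a * b) \<cdot>\<^sub>m A"
  by (rule eq_matI) (auto simp: mult.assoc)

lemma one_smult_mat [simp]: "(1 :: 'a::monoid_mult) \<cdot>\<^sub>m A = A"
  by (rule eq_matI) auto

lemma smult_mat_mult_mat:
  assumes "A \<in> carrier_mat nr n" "B \<in> carrier_mat n nc"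
  shows "(a \<cdot>\<^sub>m A) * (b \<cdot>\<^sub>m B) = (a * b) \<cdot>\<^sub>m (A * B :: 'a::comm_semiring_0 mat)"
proof -
  have "(a \<cdot>\<^sub>m A) * (b \<cdot>\<^sub>m B) = a \<cdot>\<^sub>m (A * (b \<cdot>\<^sub>m B))"
    using assms by (intro mult_smult_assoc_mat) auto
  also have "\<dots> = (a * b) \<cdot>\<^sub>m (A * B)"
    using assms by (simp add: mult_smult_distrib smult_smult_mat)
  finally show ?thesis .
qed

lemma smult_mat_mult_vec:
  assumes "A \<in> carrier_mat nr nc" "v \<in> carrier_vec nc"
  shows "(k \<cdot>\<^sub>m A) *\<^sub>v v = k \<cdot>\<^sub>v (A *\<^sub>v v :: 'a::comm_semiring_0 vec)"
  using assms by (intro eq_vecI) (auto simp: scalar_prod_def sum_distrib_left mult_ac)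

lemma mat_dim_0_unique: "A \<in> carrier_mat 0 0 \<Longrightarrow> B \<in> carrier_mat 0 0 \<Longrightarrow> A = B"
  by (rule eq_matI) auto

lemma carrier_vec_0: "carrier_vec 0 = {0\<^sub>v 0}"
  by (auto intro: eq_vecI)

lemma carrier_vec_eq_zero_imp_dim_0:
  "carrier_vec n = {0\<^sub>v n :: 'a::zero_neq_one vec} \<Longrightarrow> n = 0"
  by (metis index_unit_vec(1) index_zero_vec(1) neq0_conv unit_vec_carrier singletonD zero_neq_one)

lemma mult_mat_vec_zero: "A \<in> carrier_mat nr nc \<Longrightarrow> A *\<^sub>v 0\<^sub>v nc = (0\<^sub>v nr :: 'a::semiring_0 vec)"
  by (intro eq_vecI) auto

lemma smult_zero_vec: "c \<cdot>\<^sub>v 0\<^sub>v n = (0\<^sub>v n :: 'a::mult_zero vec)"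
  by (intro eq_vecI) auto

lemma one_mat_through_dim_0:
  assumes "A \<in> carrier_mat n 0" "B \<in> carrier_mat 0 n" "A * B = (1\<^sub>m n :: 'a::semiring_1 mat)"
  shows "n = 0"
proof (rule ccontr)
  assume "n \<noteq> 0"
  then have "(A * B) $$ (0, 0) = 0" using assms(1,2) by (simp add: scalar_prod_def)
  then show False using assms(3) \<open>n \<noteq> 0\<close> by simp
qed

lemma one_mat_mult_vec_image: "S \<subseteq> carrier_vec n \<Longrightarrow> (*\<^sub>v) (1\<^sub>m n) ` S = (S :: 'a::semiring_1 vec set)"
  by (force simp: subset_iff)

lemma mult_mat_vec_right_inverse:
  assumes "A \<in> carrier_mat m n" "B \<in> carrier_mat n m" "A * B = 1\<^sub>m m" "v \<in> carrier_vec m"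
  shows "A *\<^sub>v (B *\<^sub>v v) = (v :: 'a::semiring_1 vec)"
  using assms by (metis assoc_mult_mat_vec one_mult_mat_vec)

lemma mult_mat_vec_left_inverse_eq_0:
  assumes "A \<in> carrier_mat m n" "B \<in> carrier_mat n m" "B * A = 1\<^sub>m n"
    "w \<in> carrier_vec n" "A *\<^sub>v w = 0\<^sub>v m"
  shows "w = (0\<^sub>v n :: 'a::semiring_1 vec)"
  using mult_mat_vec_right_inverse[OF assms(2,1,3,4)] assms(2,5) by (simp add: mult_mat_vec_zero)

lemma smult_mat_inverse:
  assumes "A \<in> carrier_mat n n" "B \<in> carrier_mat n n" "A * B = 1\<^sub>m n" "B * A = 1\<^sub>m n" "c \<noteq> 0"
  shows "(c \<cdot>\<^sub>m A) * (inverse c \<cdot>\<^sub>m B) = 1\<^sub>m n" "(inverse c \<cdot>\<^sub>m B) * (c \<cdot>\<^sub>m A) = (1\<^sub>m n :: 'a::field mat)"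
  using assms by (simp_all add: smult_mat_mult_mat)

lemma mult_mat_inverse_mult:
  assumes P: "P \<in> carrier_mat m n" "Q \<in> carrier_mat n m" "Q * P = 1\<^sub>m n"
    and P': "P' \<in> carrier_mat k m" "Q' \<in> carrier_mat m k" "Q' * P' = 1\<^sub>m m"
  shows "(Q * Q') * (P' * P) = (1\<^sub>m n :: 'a::semiring_1 mat)"
proof -
  have "(Q * Q') * (P' * P) = Q * ((Q' * P') * P)"
    using assoc_mult_mat[OF P(2) P'(2) mult_carrier_mat[OF P'(1) P(1)]]
      assoc_mult_mat[OF P'(2) P'(1) P(1)] by simp
  then show ?thesis using P P' by simp
qed

lemma intertwiner_inverse:
  assumes P1: "P1 \<in> carrier_mat m1 n1" and Q1: "Q1 \<in> carrier_mat n1 m1" and PQ1: "P1 * Q1 = 1\<^sub>m m1"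
    and P2: "P2 \<in> carrier_mat m2 n2" and Q2: "Q2 \<in> carrier_mat n2 m2" and QP2: "Q2 * P2 = 1\<^sub>m n2"
    and A: "A \<in> carrier_mat n2 n1" and B: "B \<in> carrier_mat m2 m1" and intw: "P2 * A = B * P1"
  shows "Q2 * B = A * (Q1 :: 'a::semiring_1 mat)"
proof -
  have "Q2 * B = Q2 * ((B * P1) * Q1)"
    using B P1 Q1 PQ1 by (simp add: assoc_mult_mat[OF B P1 Q1])
  also have "\<dots> = (Q2 * P2) * (A * Q1)"
    unfolding intw[symmetric] using Q2 P2 A Q1
    by (simp add: assoc_mult_mat[OF P2 A Q1] assoc_mult_mat[OF Q2 P2 mult_carrier_mat[OF A Q1]])
  also have "\<dots> = A * Q1" using A Q1 QP2 by simp
  finally show ?thesis .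
qed

lemma intertwiner_mult:
  assumes P1: "P1 \<in> carrier_mat m1 n1" and P2: "P2 \<in> carrier_mat m2 n2"
    and R1: "R1 \<in> carrier_mat k1 m1" and R2: "R2 \<in> carrier_mat k2 m2"
    and A: "A \<in> carrier_mat n2 n1" and B: "B \<in> carrier_mat m2 m1" and C: "C \<in> carrier_mat k2 k1"
    and intw1: "P2 * A = B * P1" and intw2: "R2 * B = C * R1"
  shows "(R2 * P2) * A = C * (R1 * (P1 :: 'a::semiring_1 mat))"
proof -
  have "(R2 * P2) * A = (R2 * B) * P1"
    using assoc_mult_mat[OF R2 P2 A] assoc_mult_mat[OF R2 B P1] intw1 by simp
  also have "\<dots> = C * (R1 * P1)" using assoc_mult_mat[OF C R1 P1] intw2 by simp
  finally show ?thesis .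
qed

lemma lin_subspace_carrier_vec: "lin_subspace n (carrier_vec n)"
  unfolding lin_subspace_def by auto

lemma lin_subspace_zero: "lin_subspace n {0\<^sub>v n :: 'a::field vec}"
  unfolding lin_subspace_def by (auto simp: smult_zero_vec)

lemma lin_subspace_dim_0: "lin_subspace 0 S \<Longrightarrow> S = carrier_vec 0"
  unfolding lin_subspace_def carrier_vec_0 by auto

lemma lin_subspace_image:
  assumes A: "A \<in> carrier_mat m n" and S: "lin_subspace n S"
  shows "lin_subspace m ((*\<^sub>v) A ` S)"
proof -
  have "S \<subseteq> carrier_vec n" using S unfolding lin_subspace_def by blast
  moreover have "0\<^sub>v m \<in> (*\<^sub>v) A ` S"
    using S mult_mat_vec_zero[OF A] unfolding lin_subspace_def by (metis image_eqI)
  ultimately show ?thesis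
    using S A unfolding lin_subspace_def
    by (auto simp: mult_add_distrib_mat_vec[OF A, symmetric] mult_mat_vec[OF A, symmetric] subsetD
        intro!: imageI)
qed

lemma equiv_on_pred:
  assumes "\<And>x. x \<in> A \<Longrightarrow> P x x"
    and "\<And>x y. x \<in> A \<Longrightarrow> y \<in> A \<Longrightarrow> P x y \<Longrightarrow> P y x"
    and "\<And>x y z. x \<in> A \<Longrightarrow> y \<in> A \<Longrightarrow> z \<in> A \<Longrightarrow> P x y \<Longrightarrow> P y z \<Longrightarrow> P x z"
  shows "equiv A {(x, y). x \<in> A \<and> y \<in> A \<and> P x y}"
  unfolding equiv_def refl_on_def sym_def trans_def using assms by blast

lemma Image_image_equiv_class:
  assumes r: "equiv A r" and s: "trans s" and a: "a \<in> A"
    and resp: "\<And>y. (a, y) \<in> r \<Longrightarrow> (f a, f y) \<in> s"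
  shows "s `` (f ` (r `` {a})) = s `` {f a}"
proof
  show "s `` (f ` (r `` {a})) \<subseteq> s `` {f a}"
    using resp s unfolding trans_def by blast
  have "f a \<in> f ` (r `` {a})" using r a unfolding equiv_def refl_on_def by blast
  then show "s `` {f a} \<subseteq> s `` (f ` (r `` {a}))" by blast
qed

lemma bij_betw_quotients:
  assumes r: "equiv A r" and s: "equiv B s" and f: "\<And>a. a \<in> A \<Longrightarrow> f a \<in> B"
    and resp: "\<And>x y. x \<in> A \<Longrightarrow> y \<in> A \<Longrightarrow> (f x, f y) \<in> s \<longleftrightarrow> (x, y) \<in> r"
    and surj: "\<And>b. b \<in> B \<Longrightarrow> \<exists>a\<in>A. (f a, b) \<in> s"
  shows "bij_betw (\<lambda>C. s `` (f ` C)) (A // r) (B // s)"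
proof -
  have class_image: "s `` (f ` (r `` {a})) = s `` {f a}" if a: "a \<in> A" for a
  proof (rule Image_image_equiv_class[OF r _ a])
    show "trans s" using s unfolding equiv_def by blast
    show "(f a, f y) \<in> s" if "(a, y) \<in> r" for y
      using that resp[OF a] r unfolding equiv_def refl_on_def by blast
  qed
  show ?thesis
    unfolding bij_betw_def
  proof
    show "inj_on (\<lambda>C. s `` (f ` C)) (A // r)"
    proof (rule inj_onI)
      fix C1 C2 assume C: "C1 \<in> A // r" "C2 \<in> A // r" and eq: "s `` (f ` C1) = s `` (f ` C2)"
      obtain a1 where a1: "a1 \<in> A" "C1 = r `` {a1}" using C(1) by (rule quotientE) blast
      obtain a2 where a2: "a2 \<in> A" "C2 = r `` {a2}" using C(2) by (rule quotientE) blast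
      have "s `` {f a1} = s `` {f a2}"
        using eq unfolding a1(2) a2(2) class_image[OF a1(1)] class_image[OF a2(1)] .
      then have "(a1, a2) \<in> r" using eq_equiv_class_iff[OF s f[OF a1(1)] f[OF a2(1)]] resp a1 a2 by blast
      then show "C1 = C2" using eq_equiv_class_iff[OF r a1(1) a2(1)] a1 a2 by simp
    qed
    show "(\<lambda>C. s `` (f ` C)) ` (A // r) = B // s"
    proof
      show "(\<lambda>C. s `` (f ` C)) ` (A // r) \<subseteq> B // s"
      proof
        fix D assume "D \<in> (\<lambda>C. s `` (f ` C)) ` (A // r)"
        then obtain C where C: "C \<in> A // r" "D = s `` (f ` C)" by blast
        obtain a where a: "a \<in> A" "C = r `` {a}" using C(1) by (rule quotientE) blast
        show "D \<in> B // s" unfolding C(2) a(2) class_image[OF a(1)] by (rule quotientI[OF f[OF a(1)]])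
      qed
      show "B // s \<subseteq> (\<lambda>C. s `` (f ` C)) ` (A // r)"
      proof
        fix D assume "D \<in> B // s"
        then obtain b where b: "b \<in> B" "D = s `` {b}" by (rule quotientE)
        obtain a where a: "a \<in> A" "(f a, b) \<in> s" using surj[OF b(1)] by blast
        then have "s `` {f a} = s `` {b}" using eq_equiv_class_iff[OF s f[OF a(1)] b(1)] by simp
        then have "D = s `` (f ` (r `` {a}))" unfolding b(2) class_image[OF a(1)] by (rule sym)
        then show "D \<in> (\<lambda>C. s `` (f ` C)) ` (A // r)" by (rule image_eqI[OF _ quotientI[OF a(1)]])
      qed
    qed
  qed
qed

section \<open>Twisted modules\<close>

lemma tw_module_carrier: "tw_module G H \<phi> n \<rho> \<Longrightarrow> t \<in> H \<Longrightarrow> \<rho> t \<in> carrier_mat n n"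
  unfolding tw_module_def by blast

lemma tw_module_mult:
  "tw_module G H \<phi> n \<rho> \<Longrightarrow> s \<in> H \<Longrightarrow> t \<in> H \<Longrightarrow> \<rho> (s \<otimes>\<^bsub>G\<^esub> t) = \<phi> s t \<cdot>\<^sub>m (\<rho> s * \<rho> t)"
  unfolding tw_module_def by blast

lemma tw_module_one: "tw_module G H \<phi> n \<rho> \<Longrightarrow> \<rho> \<one>\<^bsub>G\<^esub> = 1\<^sub>m n"
  unfolding tw_module_def by blast

lemma (in group) tw_module_invertible:
  assumes \<rho>: "tw_module G H \<phi> n \<rho>" and h: "h \<in> H" "inv h \<in> H" "h \<in> carrier G"
  obtains B where "B \<in> carrier_mat n n" "\<rho> h * B = 1\<^sub>m n" "B * \<rho> h = (1\<^sub>m n :: 'k::field mat)"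
proof
  have car: "\<rho> h \<in> carrier_mat n n" "\<rho> (inv h) \<in> carrier_mat n n"
    using tw_module_carrier[OF \<rho>] h by auto
  show B: "\<phi> h (inv h) \<cdot>\<^sub>m \<rho> (inv h) \<in> carrier_mat n n" using car by simp
  have "1\<^sub>m n = \<rho> (h \<otimes>\<^bsub>G\<^esub> inv h)" using tw_module_one[OF \<rho>] h by simp
  also have "\<dots> = \<rho> h * (\<phi> h (inv h) \<cdot>\<^sub>m \<rho> (inv h))"
    using tw_module_mult[OF \<rho> h(1,2)] mult_smult_distrib[OF car] by simp
  finally show right: "\<rho> h * (\<phi> h (inv h) \<cdot>\<^sub>m \<rho> (inv h)) = 1\<^sub>m n" ..
  show "(\<phi> h (inv h) \<cdot>\<^sub>m \<rho> (inv h)) * \<rho> h = 1\<^sub>m n"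
    by (rule mat_mult_left_right_inverse[OF car(1) B right])
qed

lemma tw_isomorphic_refl: "tw_module G H \<phi> n \<rho> \<Longrightarrow> tw_isomorphic H n \<rho> n \<rho>"
  unfolding tw_isomorphic_def by (intro exI[of _ "1\<^sub>m n"]) (auto dest: tw_module_carrier)

lemma tw_intertwiner_inverse:
  assumes "tw_module G H \<phi> n \<rho>" "tw_module G H \<phi>' n' \<rho>'"
    and PQ: "P \<in> carrier_mat n' n" "Q \<in> carrier_mat n n'" "Q * P = 1\<^sub>m n" "P * Q = 1\<^sub>m n'"
    and intw: "\<forall>t\<in>H. P * \<rho> t = \<rho>' t * P"
  shows "\<forall>t\<in>H. Q * \<rho>' t = \<rho> t * Q"
  using intertwiner_inverse[OF PQ(1,2,4) PQ(1,2,3)] intw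
    tw_module_carrier[OF assms(1)] tw_module_carrier[OF assms(2)] by blast

lemma tw_isomorphic_sym:
  assumes "tw_module G H \<phi> n \<rho>" "tw_module G H \<phi>' n' \<rho>'" "tw_isomorphic H n \<rho> n' \<rho>'"
  shows "tw_isomorphic H n' \<rho>' n \<rho>"
  using assms tw_intertwiner_inverse[OF assms(1,2)] unfolding tw_isomorphic_def by blast

lemma tw_isomorphic_trans:
  assumes "tw_module G H \<phi> n \<rho>" "tw_module G H \<phi>' n' \<rho>'" "tw_module G H \<phi>'' n'' \<rho>''"
    and "tw_isomorphic H n \<rho> n' \<rho>'" "tw_isomorphic H n' \<rho>' n'' \<rho>''"
  shows "tw_isomorphic H n \<rho> n'' \<rho>''"
proof -
  obtain P Q where PQ: "P \<in> carrier_mat n' n" "Q \<in> carrier_mat n n'" "Q * P = 1\<^sub>m n" "P * Q = 1\<^sub>m n'"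
    and intw: "\<forall>t\<in>H. P * \<rho> t = \<rho>' t * P"
    using assms(4) unfolding tw_isomorphic_def by blast
  obtain P' Q' where PQ': "P' \<in> carrier_mat n'' n'" "Q' \<in> carrier_mat n' n''" "Q' * P' = 1\<^sub>m n'"
      "P' * Q' = 1\<^sub>m n''"
    and intw': "\<forall>t\<in>H. P' * \<rho>' t = \<rho>'' t * P'"
    using assms(5) unfolding tw_isomorphic_def by blast
  have "(P' * P) * \<rho> t = \<rho>'' t * (P' * P)" if "t \<in> H" for t
    using intertwiner_mult[OF PQ(1) PQ(1) PQ'(1) PQ'(1)] intw intw' that
      tw_module_carrier[OF assms(1)] tw_module_carrier[OF assms(2)] tw_module_carrier[OF assms(3)]
    by blast
  moreover have "(Q * Q') * (P' * P) = 1\<^sub>m n" "(P' * P) * (Q * Q') = 1\<^sub>m n''"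
    using mult_mat_inverse_mult PQ PQ' by blast+
  ultimately show ?thesis
    unfolding tw_isomorphic_def using PQ(1,2) PQ'(1,2) by (meson mult_carrier_mat)
qed

lemma Gamma_set_tw_module:
  "(a, n, \<rho>) \<in> Gamma_set G act \<gamma> R \<Longrightarrow> tw_module G (stabilizer G act a) (\<lambda>g h. \<gamma> g h a) n \<rho>"
  unfolding Gamma_set_def tw_irreducible_def by blast

lemma Gamma_classes_equiv:
  "equiv (Gamma_set G act \<gamma> R)
     {((a, n, \<rho>), (a', n', \<rho>')).
        (a, n, \<rho>) \<in> Gamma_set G act \<gamma> R \<and> (a', n', \<rho>') \<in> Gamma_set G act \<gamma> R \<and>
        a = a' \<and> tw_isomorphic (stabilizer G act a) n \<rho> n' \<rho>'}"
proof -
  let ?P = "\<lambda>(a, n, \<rho>) (a', n', \<rho>'). a = a' \<and> tw_isomorphic (stabilizer G act a) n \<rho> n' \<rho>'"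
  have "equiv (Gamma_set G act \<gamma> R) {(p, q). p \<in> Gamma_set G act \<gamma> R \<and> q \<in> Gamma_set G act \<gamma> R \<and> ?P p q}"
  proof (rule equiv_on_pred)
    show "?P p p" if "p \<in> Gamma_set G act \<gamma> R" for p
      using that by (cases p) (auto intro: tw_isomorphic_refl[OF Gamma_set_tw_module])
    show "?P q p" if "p \<in> Gamma_set G act \<gamma> R" "q \<in> Gamma_set G act \<gamma> R" "?P p q" for p q
      using that
      by (cases p, cases q) (auto intro: tw_isomorphic_sym[OF Gamma_set_tw_module Gamma_set_tw_module])
    show "?P p r" if "p \<in> Gamma_set G act \<gamma> R" "q \<in> Gamma_set G act \<gamma> R" "r \<in> Gamma_set G act \<gamma> R"
      "?P p q" "?P q r" for p q r
      using that by (cases p, cases q, cases r)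
        (auto intro: tw_isomorphic_trans[OF Gamma_set_tw_module Gamma_set_tw_module Gamma_set_tw_module])
  qed
  then show ?thesis by (simp add: split_def)
qed

section \<open>Equivariant objects\<close>

lemma eq_object_carrier:
  "eq_object G X act \<gamma> V \<Longrightarrow> g \<in> carrier G \<Longrightarrow> x \<in> carrier X \<Longrightarrow>
    snd V g x \<in> carrier_mat (fst V (act g x)) (fst V x)"
  unfolding eq_object_def Let_def by blast

lemma eq_object_invertible:
  assumes "eq_object G X act \<gamma> V" "g \<in> carrier G" "x \<in> carrier X"
  obtains v where "v \<in> carrier_mat (fst V x) (fst V (act g x))"
    "v * snd V g x = 1\<^sub>m (fst V x)" "snd V g x * v = 1\<^sub>m (fst V (act g x))"
  using assms unfolding eq_object_def Let_def by blast

lemma eq_object_mult: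
  "eq_object G X act \<gamma> V \<Longrightarrow> g \<in> carrier G \<Longrightarrow> h \<in> carrier G \<Longrightarrow> x \<in> carrier X \<Longrightarrow>
    snd V (g \<otimes>\<^bsub>G\<^esub> h) x = \<gamma> g h x \<cdot>\<^sub>m (snd V g (act h x) * snd V h x)"
  unfolding eq_object_def Let_def by blast

lemma eq_morphism_carrier:
  "eq_morphism G X act f V W \<Longrightarrow> x \<in> carrier X \<Longrightarrow> f x \<in> carrier_mat (fst W x) (fst V x)"
  unfolding eq_morphism_def by blast

lemma eq_morphism_commute:
  "eq_morphism G X act f V W \<Longrightarrow> g \<in> carrier G \<Longrightarrow> x \<in> carrier X \<Longrightarrow>
    f (act g x) * snd V g x = snd W g x * f x"
  unfolding eq_morphism_def by blast

lemma eq_simple_object: "eq_simple G X act \<gamma> V \<Longrightarrow> eq_object G X act \<gamma> V"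
  unfolding eq_simple_def by blast

lemma eq_simple_subobject:
  "eq_simple G X act \<gamma> V \<Longrightarrow> eq_subobject G X act V W \<Longrightarrow>
    (\<forall>x\<in>carrier X. W x = {0\<^sub>v (fst V x)}) \<or> (\<forall>x\<in>carrier X. W x = carrier_vec (fst V x))"
  unfolding eq_simple_def by blast

locale carrier_action = group G for G :: "('g, 'a) monoid_scheme" (structure) +
  fixes X :: "('x, 'b) monoid_scheme" and act :: "'g \<Rightarrow> 'x \<Rightarrow> 'x"
  assumes act_closed: "g \<in> carrier G \<Longrightarrow> x \<in> carrier X \<Longrightarrow> act g x \<in> carrier X"
    and act_one: "x \<in> carrier X \<Longrightarrow> act \<one> x = x"
    and act_mult: "g \<in> carrier G \<Longrightarrow> h \<in> carrier G \<Longrightarrow> x \<in> carrier X \<Longrightarrow>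
      act (g \<otimes> h) x = act g (act h x)"
begin

lemma act_inv_act: "g \<in> carrier G \<Longrightarrow> x \<in> carrier X \<Longrightarrow> act (inv g) (act g x) = x"
  by (simp add: act_mult[symmetric] act_one)

lemma stabilizer_iff: "h \<in> stabilizer G act a \<longleftrightarrow> h \<in> carrier G \<and> act h a = a"
  by (simp add: stabilizer_def)

lemma stabilizer_inv: "h \<in> stabilizer G act a \<Longrightarrow> a \<in> carrier X \<Longrightarrow> inv h \<in> stabilizer G act a"
  by (metis act_inv_act inv_closed stabilizer_iff)

definition orbit :: "'x \<Rightarrow> 'x set" where
  "orbit a = {act g a | g. g \<in> carrier G}"

definition orbit_rep :: "'x \<Rightarrow> 'x \<Rightarrow> 'g" where
  "orbit_rep a x = (if x = a then \<one> else (SOME g. g \<in> carrier G \<and> act g a = x))"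

definition stab_part :: "'x \<Rightarrow> 'g \<Rightarrow> 'x \<Rightarrow> 'g" where
  "stab_part a g x = inv (orbit_rep a (act g x)) \<otimes> g \<otimes> orbit_rep a x"

lemma orbit_subset: "a \<in> carrier X \<Longrightarrow> orbit a \<subseteq> carrier X"
  unfolding orbit_def using act_closed by auto

lemma self_in_orbit: "a \<in> carrier X \<Longrightarrow> a \<in> orbit a"
  unfolding orbit_def using act_one by force

lemma act_in_orbit_iff:
  assumes "a \<in> carrier X" "g \<in> carrier G" "x \<in> carrier X"
  shows "act g x \<in> orbit a \<longleftrightarrow> x \<in> orbit a"
proof
  assume "act g x \<in> orbit a"
  then obtain k where "k \<in> carrier G" "act g x = act k a" unfolding orbit_def by auto
  then have "x = act (inv g \<otimes> k) a" using assms by (metis act_inv_act act_mult inv_closed)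
  then show "x \<in> orbit a" unfolding orbit_def using \<open>k \<in> carrier G\<close> assms(2) by blast
next
  assume "x \<in> orbit a"
  then obtain k where "k \<in> carrier G" "x = act k a" unfolding orbit_def by auto
  then have "act g x = act (g \<otimes> k) a" using assms by (simp add: act_mult)
  then show "act g x \<in> orbit a" unfolding orbit_def using \<open>k \<in> carrier G\<close> assms(2) by blast
qed

lemma orbit_rep_self: "orbit_rep a a = \<one>"
  by (simp add: orbit_rep_def)

lemma orbit_rep:
  assumes "a \<in> carrier X" "x \<in> orbit a"
  shows "orbit_rep a x \<in> carrier G" "act (orbit_rep a x) a = x"
proof -
  have "\<exists>g. g \<in> carrier G \<and> act g a = x" using assms(2) unfolding orbit_def by blast
  from someI_ex[OF this] have "orbit_rep a x \<in> carrier G \<and> act (orbit_rep a x) a = x"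
    using assms(1) act_one unfolding orbit_rep_def by (cases "x = a") simp_all
  then show "orbit_rep a x \<in> carrier G" "act (orbit_rep a x) a = x" by auto
qed

lemma stab_part_in_stabilizer:
  assumes a: "a \<in> carrier X" and g: "g \<in> carrier G" and x: "x \<in> orbit a"
  shows "stab_part a g x \<in> stabilizer G act a"
proof -
  have xX: "x \<in> carrier X" using x orbit_subset[OF a] by blast
  have gx: "act g x \<in> orbit a" using act_in_orbit_iff[OF a g xX] x by simp
  note rx = orbit_rep[OF a x] and rgx = orbit_rep[OF a gx]
  have "act (stab_part a g x) a = act (inv (orbit_rep a (act g x))) (act g (act (orbit_rep a x) a))"
    unfolding stab_part_def using a g rx rgx xX by (simp add: act_mult)
  also have "\<dots> = a" using rx rgx g by (metis act_inv_act a)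
  finally show ?thesis unfolding stabilizer_iff stab_part_def using rx rgx g by simp
qed

lemma orbit_rep_mult_stab_part:
  assumes a: "a \<in> carrier X" and g: "g \<in> carrier G" and x: "x \<in> orbit a"
  shows "orbit_rep a (act g x) \<otimes> stab_part a g x = g \<otimes> orbit_rep a x"
proof -
  have gx: "act g x \<in> orbit a" using act_in_orbit_iff[OF a g] x orbit_subset[OF a] by blast
  show ?thesis
    unfolding stab_part_def using orbit_rep[OF a x] orbit_rep[OF a gx] g by (simp add: m_assoc[symmetric])
qed

lemma stab_part_mult:
  assumes a: "a \<in> carrier X" and g: "g \<in> carrier G" and k: "k \<in> carrier G" and x: "x \<in> orbit a"
  shows "stab_part a (g \<otimes> k) x = stab_part a g (act k x) \<otimes> stab_part a k x"
proof -
  have xX: "x \<in> carrier X" using x orbit_subset[OF a] by blast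
  have kx: "act k x \<in> orbit a" using act_in_orbit_iff[OF a k xX] x by simp
  have gkx: "act g (act k x) \<in> orbit a" using act_in_orbit_iff[OF a g act_closed[OF k xX]] kx by simp
  have cancel: "u \<otimes> (inv u \<otimes> v) = v" if "u \<in> carrier G" "v \<in> carrier G" for u v
    using that by (simp add: m_assoc[symmetric])
  show ?thesis
    unfolding stab_part_def using orbit_rep[OF a x] orbit_rep[OF a kx] orbit_rep[OF a gkx] g k xX
    by (simp add: act_mult m_assoc cancel)
qed

lemma stab_part_stabilizer: "h \<in> stabilizer G act a \<Longrightarrow> stab_part a h a = h"
  unfolding stabilizer_iff stab_part_def by (simp add: orbit_rep_self)

lemma eq_morphism_inverse:
  assumes V: "eq_object G X act \<gamma> V" and W: "eq_object G X act \<gamma> W"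
    and f': "eq_morphism G X act f' W V"
    and f: "\<And>x. x \<in> carrier X \<Longrightarrow> f x \<in> carrier_mat (fst W x) (fst V x)"
    and ff': "\<And>x. x \<in> carrier X \<Longrightarrow> f x * f' x = 1\<^sub>m (fst W x)"
    and f'f: "\<And>x. x \<in> carrier X \<Longrightarrow> f' x * f x = 1\<^sub>m (fst V x)"
  shows "eq_morphism G X act f V W"
  unfolding eq_morphism_def
proof (intro conjI ballI f)
  fix g x assume g: "g \<in> carrier G" and x: "x \<in> carrier X"
  then have gx: "act g x \<in> carrier X" by (rule act_closed)
  show "f (act g x) * snd V g x = snd W g x * f x"
    by (rule intertwiner_inverse[OF eq_morphism_carrier[OF f' x] f[OF x] f'f[OF x]
          eq_morphism_carrier[OF f' gx] f[OF gx] ff'[OF gx]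
          eq_object_carrier[OF W g x] eq_object_carrier[OF V g x] eq_morphism_commute[OF f' g x]])
qed

lemma eq_isomorphic_refl: "eq_object G X act \<gamma> V \<Longrightarrow> eq_isomorphic G X act V V"
  unfolding eq_isomorphic_def eq_morphism_def
  by (intro exI[of _ "\<lambda>x. 1\<^sub>m (fst V x)"]) (auto dest: eq_object_carrier)

lemma eq_isomorphic_sym: "eq_isomorphic G X act V W \<Longrightarrow> eq_isomorphic G X act W V"
  unfolding eq_isomorphic_def by blast

lemma eq_morphism_comp:
  assumes A: "eq_object G X act \<gamma> A" and B: "eq_object G X act \<gamma> B" and C: "eq_object G X act \<gamma> C"
    and h1: "eq_morphism G X act h1 A B" and h2: "eq_morphism G X act h2 B C"
  shows "eq_morphism G X act (\<lambda>x. h2 x * h1 x) A C"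
  unfolding eq_morphism_def
proof (intro conjI ballI)
  fix x assume x: "x \<in> carrier X"
  show "h2 x * h1 x \<in> carrier_mat (fst C x) (fst A x)"
    using eq_morphism_carrier[OF h1 x] eq_morphism_carrier[OF h2 x] by simp
next
  fix g x assume g: "g \<in> carrier G" and x: "x \<in> carrier X"
  then have gx: "act g x \<in> carrier X" by (rule act_closed)
  show "h2 (act g x) * h1 (act g x) * snd A g x = snd C g x * (h2 x * h1 x)"
    by (rule intertwiner_mult[OF eq_morphism_carrier[OF h1 x] eq_morphism_carrier[OF h1 gx]
          eq_morphism_carrier[OF h2 x] eq_morphism_carrier[OF h2 gx] eq_object_carrier[OF A g x]
          eq_object_carrier[OF B g x] eq_object_carrier[OF C g x]
          eq_morphism_commute[OF h1 g x] eq_morphism_commute[OF h2 g x]])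
qed

lemma eq_isomorphic_trans:
  assumes U: "eq_object G X act \<gamma> U" and V: "eq_object G X act \<gamma> V" and W: "eq_object G X act \<gamma> W"
    and "eq_isomorphic G X act U V" "eq_isomorphic G X act V W"
  shows "eq_isomorphic G X act U W"
proof -
  obtain f1 f1' where f1: "eq_morphism G X act f1 U V" "eq_morphism G X act f1' V U"
    and inv1: "\<forall>x\<in>carrier X. f1' x * f1 x = 1\<^sub>m (fst U x) \<and> f1 x * f1' x = 1\<^sub>m (fst V x)"
    using assms(4) unfolding eq_isomorphic_def by blast
  obtain f2 f2' where f2: "eq_morphism G X act f2 V W" "eq_morphism G X act f2' W V"
    and inv2: "\<forall>x\<in>carrier X. f2' x * f2 x = 1\<^sub>m (fst V x) \<and> f2 x * f2' x = 1\<^sub>m (fst W x)"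
    using assms(5) unfolding eq_isomorphic_def by blast
  have "\<forall>x\<in>carrier X. (f1' x * f2' x) * (f2 x * f1 x) = 1\<^sub>m (fst U x) \<and>
      (f2 x * f1 x) * (f1' x * f2' x) = 1\<^sub>m (fst W x)"
  proof
    fix x assume x: "x \<in> carrier X"
    note c = eq_morphism_carrier[OF f1(1) x] eq_morphism_carrier[OF f1(2) x]
      eq_morphism_carrier[OF f2(1) x] eq_morphism_carrier[OF f2(2) x]
    show "(f1' x * f2' x) * (f2 x * f1 x) = 1\<^sub>m (fst U x) \<and>
      (f2 x * f1 x) * (f1' x * f2' x) = 1\<^sub>m (fst W x)"
      using mult_mat_inverse_mult[OF c(1,2) _ c(3,4)] mult_mat_inverse_mult[OF c(4,3) _ c(2,1)]
        inv1 inv2 x by blast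
  qed
  then show ?thesis
    unfolding eq_isomorphic_def
    using eq_morphism_comp[OF U V W f1(1) f2(1)] eq_morphism_comp[OF W V U f2(2) f1(2)] by blast
qed

lemma eq_isomorphic_if_invertible:
  assumes V: "eq_object G X act \<gamma> V" and W: "eq_object G X act \<gamma> W" and f: "eq_morphism G X act f V W"
    and invertible: "\<And>x. x \<in> carrier X \<Longrightarrow>
      \<exists>v. v \<in> carrier_mat (fst V x) (fst W x) \<and> v * f x = 1\<^sub>m (fst V x) \<and> f x * v = 1\<^sub>m (fst W x)"
  shows "eq_isomorphic G X act V W"
proof -
  define f' where "f' x = (SOME v. v \<in> carrier_mat (fst V x) (fst W x) \<and>
    v * f x = 1\<^sub>m (fst V x) \<and> f x * v = 1\<^sub>m (fst W x))" for x
  have f': "f' x \<in> carrier_mat (fst V x) (fst W x)" "f' x * f x = 1\<^sub>m (fst V x)" "f x * f' x = 1\<^sub>m (fst W x)"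
    if "x \<in> carrier X" for x
    using someI_ex[OF invertible[OF that]] unfolding f'_def by blast+
  then have "eq_morphism G X act f' W V" by (intro eq_morphism_inverse[OF W V f]) auto
  then show ?thesis unfolding eq_isomorphic_def using f f' by blast
qed

lemma eq_subobject_zero_transport:
  assumes V: "eq_object G X act \<gamma> V" and W: "eq_subobject G X act V W"
    and g: "g \<in> carrier G" and x: "x \<in> carrier X" and zero: "W (act g x) = {0\<^sub>v (fst V (act g x))}"
  shows "W x = {0\<^sub>v (fst V x)}"
proof -
  obtain v where v: "v \<in> carrier_mat (fst V x) (fst V (act g x))" "v * snd V g x = 1\<^sub>m (fst V x)"
    using eq_object_invertible[OF V g x] by blast
  have sub: "lin_subspace (fst V x) (W x)" using W x unfolding eq_subobject_def by blast
  have "w = 0\<^sub>v (fst V x)" if "w \<in> W x" for w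
  proof (rule mult_mat_vec_left_inverse_eq_0[OF eq_object_carrier[OF V g x] v])
    show "w \<in> carrier_vec (fst V x)" using sub that unfolding lin_subspace_def by blast
    show "snd V g x *\<^sub>v w = 0\<^sub>v (fst V (act g x))"
      using W g x that zero unfolding eq_subobject_def by blast
  qed
  moreover have "0\<^sub>v (fst V x) \<in> W x" using sub unfolding lin_subspace_def by blast
  ultimately show ?thesis by blast
qed

lemma eq_subobject_full_transport:
  assumes V: "eq_object G X act \<gamma> V" and W: "eq_subobject G X act V W"
    and g: "g \<in> carrier G" and x: "x \<in> carrier X" and full: "W x = carrier_vec (fst V x)"
  shows "W (act g x) = carrier_vec (fst V (act g x))"
proof -
  obtain v where v: "v \<in> carrier_mat (fst V x) (fst V (act g x))"
    "snd V g x * v = 1\<^sub>m (fst V (act g x))"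
    using eq_object_invertible[OF V g x] by blast
  have "w \<in> W (act g x)" if w: "w \<in> carrier_vec (fst V (act g x))" for w
  proof -
    have "snd V g x *\<^sub>v (v *\<^sub>v w) \<in> W (act g x)"
      using W g x v(1) w full unfolding eq_subobject_def by simp
    then show ?thesis
      using mult_mat_vec_right_inverse[OF eq_object_carrier[OF V g x] v w] by simp
  qed
  moreover have "W (act g x) \<subseteq> carrier_vec (fst V (act g x))"
    using W act_closed[OF g x] unfolding eq_subobject_def lin_subspace_def by blast
  ultimately show ?thesis by blast
qed

lemma eq_simple_if_orbit_supported:
  assumes V: "eq_object G X act \<gamma> V" and a: "a \<in> carrier X"
    and supp: "\<And>x. x \<in> carrier X \<Longrightarrow> x \<notin> orbit a \<Longrightarrow> fst V x = 0" and nz: "fst V a \<noteq> 0"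
    and irr: "\<And>W. eq_subobject G X act V W \<Longrightarrow> W a = {0\<^sub>v (fst V a)} \<or> W a = carrier_vec (fst V a)"
  shows "eq_simple G X act \<gamma> V"
proof -
  have "(\<forall>x\<in>carrier X. W x = {0\<^sub>v (fst V x)}) \<or> (\<forall>x\<in>carrier X. W x = carrier_vec (fst V x))"
    if W: "eq_subobject G X act V W" for W
  proof -
    have off: "W x = {0\<^sub>v (fst V x)} \<and> W x = carrier_vec (fst V x)"
      if "x \<in> carrier X" "x \<notin> orbit a" for x
      using W that supp[OF that] lin_subspace_dim_0 carrier_vec_0 unfolding eq_subobject_def by metis
    from irr[OF W] show ?thesis
    proof
      assume zero: "W a = {0\<^sub>v (fst V a)}"
      have "W x = {0\<^sub>v (fst V x)}" if x: "x \<in> carrier X" "x \<in> orbit a" for x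
        using eq_subobject_zero_transport[OF V W inv_closed[OF orbit_rep(1)[OF a x(2)]] x(1)]
          zero orbit_rep[OF a x(2)] act_inv_act a by metis
      then show ?thesis using off by blast
    next
      assume full: "W a = carrier_vec (fst V a)"
      have "W x = carrier_vec (fst V x)" if x: "x \<in> orbit a" for x
        using eq_subobject_full_transport[OF V W orbit_rep(1)[OF a x] a full] orbit_rep(2)[OF a x]
        by simp
      then show ?thesis using off by blast
    qed
  qed
  then show ?thesis unfolding eq_simple_def using V a nz by blast
qed

lemma eq_object_dim_zero_act:
  assumes V: "eq_object G X act \<gamma> V" and g: "g \<in> carrier G" and x: "x \<in> carrier X"
    and zero: "fst V x = 0"
  shows "fst V (act g x) = 0"
proof -
  obtain v where "v \<in> carrier_mat (fst V x) (fst V (act g x))" "snd V g x * v = 1\<^sub>m (fst V (act g x))"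
    using eq_object_invertible[OF V g x] by blast
  then show ?thesis
    using one_mat_through_dim_0[of "snd V g x" "fst V (act g x)" v] eq_object_carrier[OF V g x] zero
    by simp
qed

lemma orbit_eq_subobject:
  fixes V :: "('x, 'g, 'k::field) eq_obj"
  assumes V: "eq_object G X act \<gamma> V" and a: "a \<in> carrier X"
  shows "eq_subobject G X act V (\<lambda>x. if x \<in> orbit a then carrier_vec (fst V x) else {0\<^sub>v (fst V x)})"
  unfolding eq_subobject_def
proof (intro conjI ballI)
  show "lin_subspace (fst V x) (if x \<in> orbit a then carrier_vec (fst V x) else {0\<^sub>v (fst V x)})" for x
    by (simp add: lin_subspace_carrier_vec lin_subspace_zero)
  fix g x and w :: "'k vec" assume g: "g \<in> carrier G" and x: "x \<in> carrier X"
    and w: "w \<in> (if x \<in> orbit a then carrier_vec (fst V x) else {0\<^sub>v (fst V x)})"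
  then show "snd V g x *\<^sub>v w \<in>
      (if act g x \<in> orbit a then carrier_vec (fst V (act g x)) else {0\<^sub>v (fst V (act g x))})"
    using eq_object_carrier[OF V g x] mult_mat_vec_zero[OF eq_object_carrier[OF V g x]]
      act_in_orbit_iff[OF a g x]
    by (cases "x \<in> orbit a") simp_all
qed

lemma eq_simple_orbit_support:
  fixes V :: "('x, 'g, 'k::field) eq_obj"
  assumes V: "eq_simple G X act \<gamma> V" and a: "a \<in> carrier X"
    and x0: "x0 \<in> orbit a" and nz: "fst V x0 \<noteq> 0"
    and x: "x \<in> carrier X" "x \<notin> orbit a"
  shows "fst V x = 0"
proof -
  define W :: "'x \<Rightarrow> 'k vec set"
    where "W = (\<lambda>x. if x \<in> orbit a then carrier_vec (fst V x) else {0\<^sub>v (fst V x)})"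
  from eq_simple_subobject[OF V orbit_eq_subobject[OF eq_simple_object[OF V] a, folded W_def]]
  show ?thesis
  proof
    assume "\<forall>x\<in>carrier X. W x = {0\<^sub>v (fst V x)}"
    moreover have "x0 \<in> carrier X" using x0 orbit_subset[OF a] by blast
    ultimately have "W x0 = {0\<^sub>v (fst V x0)}" by blast
    then have "carrier_vec (fst V x0) = {0\<^sub>v (fst V x0) :: 'k vec}" unfolding W_def if_P[OF x0] .
    then have "fst V x0 = 0" by (rule carrier_vec_eq_zero_imp_dim_0)
    with nz show ?thesis by simp
  next
    assume "\<forall>x\<in>carrier X. W x = carrier_vec (fst V x)"
    then have "W x = carrier_vec (fst V x)" using x by blast
    then have "carrier_vec (fst V x) = {0\<^sub>v (fst V x) :: 'k vec}"
      unfolding W_def if_not_P[OF x(2)] by (rule sym)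
    then show ?thesis by (rule carrier_vec_eq_zero_imp_dim_0)
  qed
qed

end

section \<open>Induction from a stabilizer\<close>

locale twisted_action = carrier_action G X act for G :: "('g, 'a) monoid_scheme" (structure)
    and X :: "('x, 'b) monoid_scheme" and act +
  fixes \<gamma> :: "'g \<Rightarrow> 'g \<Rightarrow> 'x \<Rightarrow> 'k::field"
  assumes cocycle_nonzero: "g \<in> carrier G \<Longrightarrow> h \<in> carrier G \<Longrightarrow> x \<in> carrier X \<Longrightarrow> \<gamma> g h x \<noteq> 0"
    and cocycle: "g \<in> carrier G \<Longrightarrow> h \<in> carrier G \<Longrightarrow> k \<in> carrier G \<Longrightarrow> x \<in> carrier X \<Longrightarrow>
      \<gamma> h k x * \<gamma> g (h \<otimes> k) x = \<gamma> (g \<otimes> h) k x * \<gamma> g h (act k x)"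
    and cocycle_one_left: "h \<in> carrier G \<Longrightarrow> x \<in> carrier X \<Longrightarrow> \<gamma> \<one> h x = 1"
    and cocycle_one_right: "g \<in> carrier G \<Longrightarrow> x \<in> carrier X \<Longrightarrow> \<gamma> g \<one> x = 1"
begin

definition ind_factor :: "'x \<Rightarrow> 'g \<Rightarrow> 'x \<Rightarrow> 'k" where
  "ind_factor a g x = \<gamma> (orbit_rep a (act g x)) (stab_part a g x) a / \<gamma> g (orbit_rep a x) a"

definition induced :: "'x \<Rightarrow> nat \<Rightarrow> ('g \<Rightarrow> 'k mat) \<Rightarrow> ('x, 'g, 'k) eq_obj" where
  "induced a n \<rho> = ((\<lambda>x. if x \<in> orbit a then n else 0),
     (\<lambda>g x. if x \<in> orbit a then ind_factor a g x \<cdot>\<^sub>m \<rho> (stab_part a g x) else 1\<^sub>m 0))"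

lemma ind_factor_stabilizer: "a \<in> carrier X \<Longrightarrow> h \<in> stabilizer G act a \<Longrightarrow> ind_factor a h a = 1"
  unfolding ind_factor_def
  by (simp add: stab_part_stabilizer orbit_rep_self stabilizer_iff cocycle_one_left cocycle_one_right)

lemma ind_factor_nonzero:
  assumes a: "a \<in> carrier X" and g: "g \<in> carrier G" and x: "x \<in> orbit a"
  shows "ind_factor a g x \<noteq> 0"
proof -
  have gx: "act g x \<in> orbit a" using act_in_orbit_iff[OF a g] x orbit_subset[OF a] by blast
  show ?thesis
    unfolding ind_factor_def
    using cocycle_nonzero orbit_rep[OF a x] orbit_rep[OF a gx] stab_part_in_stabilizer[OF a g x]
      stabilizer_iff a g by auto
qed

lemma ind_factor_mult:
  assumes a: "a \<in> carrier X" and g: "g \<in> carrier G" and k: "k \<in> carrier G" and x: "x \<in> orbit a"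
  shows "ind_factor a (g \<otimes> k) x * \<gamma> (stab_part a g (act k x)) (stab_part a k x) a
     = \<gamma> g k x * ind_factor a g (act k x) * ind_factor a k x"
proof -
  have xX: "x \<in> carrier X" using x orbit_subset[OF a] by blast
  have kx: "act k x \<in> orbit a" using act_in_orbit_iff[OF a k xX] x by simp
  have gkx: "act g (act k x) \<in> orbit a" using act_in_orbit_iff[OF a g act_closed[OF k xX]] kx by simp
  define rx ry rz h1 h2 where "rx = orbit_rep a x" and "ry = orbit_rep a (act k x)"
    and "rz = orbit_rep a (act g (act k x))" and "h1 = stab_part a g (act k x)" and "h2 = stab_part a k x"
  have rx: "rx \<in> carrier G" "act rx a = x" using orbit_rep[OF a x] rx_def by auto
  have ry: "ry \<in> carrier G" using orbit_rep[OF a kx] ry_def by auto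
  have rz: "rz \<in> carrier G" using orbit_rep[OF a gkx] rz_def by auto
  have h1: "h1 \<in> carrier G" "act h1 a = a"
    using stab_part_in_stabilizer[OF a g kx] h1_def stabilizer_iff by auto
  have h2: "h2 \<in> carrier G" "act h2 a = a"
    using stab_part_in_stabilizer[OF a k x] h2_def stabilizer_iff by auto
  have e1: "rz \<otimes> h1 = g \<otimes> ry" using orbit_rep_mult_stab_part[OF a g kx] rz_def h1_def ry_def by simp
  have e2: "ry \<otimes> h2 = k \<otimes> rx" using orbit_rep_mult_stab_part[OF a k x] rx_def h2_def ry_def by simp
  have i: "\<gamma> rz (h1 \<otimes> h2) a * \<gamma> h1 h2 a = \<gamma> (g \<otimes> ry) h2 a * \<gamma> rz h1 a"
    using cocycle[OF rz h1(1) h2(1) a] e1 h2 by (simp add: mult.commute)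
  have ii: "\<gamma> ry h2 a * \<gamma> g (k \<otimes> rx) a = \<gamma> (g \<otimes> ry) h2 a * \<gamma> g ry a"
    using cocycle[OF g ry h2(1) a] e2 h2 by simp
  have iii: "\<gamma> k rx a * \<gamma> g (k \<otimes> rx) a = \<gamma> (g \<otimes> k) rx a * \<gamma> g k x"
    using cocycle[OF g k rx(1) a] rx by simp
  have "\<gamma> rz (h1 \<otimes> h2) a * \<gamma> h1 h2 a * \<gamma> g ry a * \<gamma> k rx a
      = \<gamma> rz h1 a * \<gamma> k rx a * (\<gamma> (g \<otimes> ry) h2 a * \<gamma> g ry a)"
    using i by (simp add: mult_ac)
  also have "\<dots> = \<gamma> rz h1 a * \<gamma> ry h2 a * (\<gamma> k rx a * \<gamma> g (k \<otimes> rx) a)"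
    using ii by (simp add: mult_ac)
  also have "\<dots> = \<gamma> rz h1 a * \<gamma> ry h2 a * (\<gamma> (g \<otimes> k) rx a * \<gamma> g k x)"
    using iii by simp
  finally have "\<gamma> rz (h1 \<otimes> h2) a * \<gamma> h1 h2 a * \<gamma> g ry a * \<gamma> k rx a
      = \<gamma> rz h1 a * \<gamma> ry h2 a * (\<gamma> (g \<otimes> k) rx a * \<gamma> g k x)" .
  moreover have "\<gamma> (g \<otimes> k) rx a \<noteq> 0" "\<gamma> g ry a \<noteq> 0" "\<gamma> k rx a \<noteq> 0"
    using cocycle_nonzero g k rx(1) ry a by simp_all
  ultimately show ?thesis
    unfolding ind_factor_def act_mult[OF g k xX] stab_part_mult[OF a g k x]
    unfolding rx_def[symmetric] ry_def[symmetric] rz_def[symmetric] h1_def[symmetric] h2_def[symmetric]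
    by (simp add: field_simps)
qed

lemma induced_dim: "fst (induced a n \<rho>) x = (if x \<in> orbit a then n else 0)"
  by (simp add: induced_def)

lemma induced_action:
  "snd (induced a n \<rho>) g x = (if x \<in> orbit a then ind_factor a g x \<cdot>\<^sub>m \<rho> (stab_part a g x) else 1\<^sub>m 0)"
  by (simp add: induced_def)

lemma induced_action_stabilizer:
  "a \<in> carrier X \<Longrightarrow> t \<in> stabilizer G act a \<Longrightarrow> snd (induced a n \<rho>) t a = \<rho> t"
  by (simp add: induced_action self_in_orbit ind_factor_stabilizer stab_part_stabilizer)

lemma induced_action_mult:
  assumes a: "a \<in> carrier X" and \<rho>: "tw_module G (stabilizer G act a) (\<lambda>g h. \<gamma> g h a) n \<rho>"
    and g: "g \<in> carrier G" and h: "h \<in> carrier G" and x: "x \<in> carrier X"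
  shows "snd (induced a n \<rho>) (g \<otimes> h) x =
    \<gamma> g h x \<cdot>\<^sub>m (snd (induced a n \<rho>) g (act h x) * snd (induced a n \<rho>) h x)"
proof (cases "x \<in> orbit a")
  case True
  have hx: "act h x \<in> orbit a" using act_in_orbit_iff[OF a h x] True by simp
  define h1 h2 where "h1 = stab_part a g (act h x)" and "h2 = stab_part a h x"
  have stab: "h1 \<in> stabilizer G act a" "h2 \<in> stabilizer G act a"
    using stab_part_in_stabilizer[OF a g hx] stab_part_in_stabilizer[OF a h True] h1_def h2_def by auto
  have "snd (induced a n \<rho>) (g \<otimes> h) x
      = (ind_factor a (g \<otimes> h) x * \<gamma> h1 h2 a) \<cdot>\<^sub>m (\<rho> h1 * \<rho> h2)"
    using True tw_module_mult[OF \<rho> stab]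
    by (simp add: induced_action stab_part_mult[OF a g h True] h1_def h2_def smult_smult_mat)
  also have "\<dots> = \<gamma> g h x \<cdot>\<^sub>m (snd (induced a n \<rho>) g (act h x) * snd (induced a n \<rho>) h x)"
    using True hx tw_module_carrier[OF \<rho> stab(1)] tw_module_carrier[OF \<rho> stab(2)]
      ind_factor_mult[OF a g h True, folded h1_def h2_def]
    by (simp add: induced_action h1_def[symmetric] h2_def[symmetric] smult_mat_mult_mat
        smult_smult_mat mult.assoc)
  finally show ?thesis .
next
  case False
  then show ?thesis
    using act_in_orbit_iff[OF a h x] by (intro mat_dim_0_unique) (simp_all add: induced_action)
qed

lemma induced_eq_object:
  assumes a: "a \<in> carrier X" and \<rho>: "tw_module G (stabilizer G act a) (\<lambda>g h. \<gamma> g h a) n \<rho>"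
  shows "eq_object G X act \<gamma> (induced a n \<rho>)"
proof -
  have invertible: "\<exists>v. v \<in> carrier_mat (fst (induced a n \<rho>) x) (fst (induced a n \<rho>) (act g x)) \<and>
      v * snd (induced a n \<rho>) g x = 1\<^sub>m (fst (induced a n \<rho>) x) \<and>
      snd (induced a n \<rho>) g x * v = 1\<^sub>m (fst (induced a n \<rho>) (act g x))"
    if g: "g \<in> carrier G" and x: "x \<in> carrier X" for g x
  proof (cases "x \<in> orbit a")
    case True
    have h: "stab_part a g x \<in> stabilizer G act a" by (rule stab_part_in_stabilizer[OF a g True])
    then obtain B where B: "B \<in> carrier_mat n n" "\<rho> (stab_part a g x) * B = 1\<^sub>m n"
      "B * \<rho> (stab_part a g x) = 1\<^sub>m n"
      using tw_module_invertible[OF \<rho>] stabilizer_inv[OF h a] stabilizer_iff by metis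
    show ?thesis
      using smult_mat_inverse[OF tw_module_carrier[OF \<rho> h] B(1-3) ind_factor_nonzero[OF a g True]]
        B(1) True act_in_orbit_iff[OF a g x] tw_module_carrier[OF \<rho> h]
      by (intro exI[of _ "inverse (ind_factor a g x) \<cdot>\<^sub>m B"]) (simp add: induced_dim induced_action)
  next
    case False
    then show ?thesis
      using act_in_orbit_iff[OF a g x] by (intro exI[of _ "1\<^sub>m 0"]) (simp add: induced_dim induced_action)
  qed
  show ?thesis
    unfolding eq_object_def Let_def using invertible induced_action_mult[OF a \<rho>]
    by (auto simp: induced_dim induced_action act_in_orbit_iff[OF a] tw_module_carrier[OF \<rho>]
        stab_part_in_stabilizer[OF a])
qed

lemma induced_simple:
  assumes a: "a \<in> carrier X" and irr: "tw_irreducible G (stabilizer G act a) (\<lambda>g h. \<gamma> g h a) n \<rho>"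
  shows "eq_simple G X act \<gamma> (induced a n \<rho>)"
proof (rule eq_simple_if_orbit_supported[OF induced_eq_object[OF a] a])
  show \<rho>: "tw_module G (stabilizer G act a) (\<lambda>g h. \<gamma> g h a) n \<rho>"
    using irr unfolding tw_irreducible_def by blast
  show "fst (induced a n \<rho>) x = 0" if "x \<notin> orbit a" for x
    using that by (simp add: induced_dim)
  show "fst (induced a n \<rho>) a \<noteq> 0"
    using irr self_in_orbit[OF a] unfolding tw_irreducible_def by (simp add: induced_dim)
  fix W assume W: "eq_subobject G X act (induced a n \<rho>) W"
  have "lin_subspace n (W a)"
    using W a self_in_orbit[OF a] unfolding eq_subobject_def by (metis induced_dim)
  moreover have "\<rho> t *\<^sub>v v \<in> W a" if t: "t \<in> stabilizer G act a" and "v \<in> W a" for t v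
    using W that a induced_action_stabilizer[OF a t] stabilizer_iff unfolding eq_subobject_def by metis
  ultimately have "W a = {0\<^sub>v n} \<or> W a = carrier_vec n" using irr unfolding tw_irreducible_def by blast
  then show "W a = {0\<^sub>v (fst (induced a n \<rho>) a)} \<or> W a = carrier_vec (fst (induced a n \<rho>) a)"
    using self_in_orbit[OF a] by (simp add: induced_dim)
qed

lemma induced_morphism:
  assumes a: "a \<in> carrier X"
    and \<rho>: "tw_module G (stabilizer G act a) (\<lambda>g h. \<gamma> g h a) n \<rho>"
    and \<rho>': "tw_module G (stabilizer G act a) (\<lambda>g h. \<gamma> g h a) n' \<rho>'"
    and P: "P \<in> carrier_mat n' n" and intw: "\<forall>t\<in>stabilizer G act a. P * \<rho> t = \<rho>' t * P"
  shows "eq_morphism G X act (\<lambda>x. if x \<in> orbit a then P else 1\<^sub>m 0) (induced a n \<rho>) (induced a n' \<rho>')"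
  unfolding eq_morphism_def
proof (intro conjI ballI)
  show "(if x \<in> orbit a then P else 1\<^sub>m 0) \<in> carrier_mat (fst (induced a n' \<rho>') x) (fst (induced a n \<rho>) x)"
    for x using P by (simp add: induced_dim)
  fix g x assume g: "g \<in> carrier G" and x: "x \<in> carrier X"
  show "(if act g x \<in> orbit a then P else 1\<^sub>m 0) * snd (induced a n \<rho>) g x =
        snd (induced a n' \<rho>') g x * (if x \<in> orbit a then P else 1\<^sub>m 0)"
  proof (cases "x \<in> orbit a")
    case True
    have h: "stab_part a g x \<in> stabilizer G act a" by (rule stab_part_in_stabilizer[OF a g True])
    show ?thesis
      using True act_in_orbit_iff[OF a g x] intw h
        mult_smult_distrib[OF P tw_module_carrier[OF \<rho> h]]
        mult_smult_assoc_mat[OF tw_module_carrier[OF \<rho>' h] P]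
      by (simp add: induced_action)
  next
    case False
    then show ?thesis using act_in_orbit_iff[OF a g x] by (simp add: induced_action)
  qed
qed

lemma induced_isomorphic:
  assumes a: "a \<in> carrier X"
    and \<rho>: "tw_module G (stabilizer G act a) (\<lambda>g h. \<gamma> g h a) n \<rho>"
    and \<rho>': "tw_module G (stabilizer G act a) (\<lambda>g h. \<gamma> g h a) n' \<rho>'"
    and iso: "tw_isomorphic (stabilizer G act a) n \<rho> n' \<rho>'"
  shows "eq_isomorphic G X act (induced a n \<rho>) (induced a n' \<rho>')"
proof -
  obtain P Q where PQ: "P \<in> carrier_mat n' n" "Q \<in> carrier_mat n n'" "Q * P = 1\<^sub>m n" "P * Q = 1\<^sub>m n'"
    and intw: "\<forall>t\<in>stabilizer G act a. P * \<rho> t = \<rho>' t * P"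
    using iso unfolding tw_isomorphic_def by blast
  have "\<forall>x\<in>carrier X. (if x \<in> orbit a then Q else 1\<^sub>m 0) * (if x \<in> orbit a then P else 1\<^sub>m 0) =
      1\<^sub>m (fst (induced a n \<rho>) x) \<and>
      (if x \<in> orbit a then P else 1\<^sub>m 0) * (if x \<in> orbit a then Q else 1\<^sub>m 0) =
      1\<^sub>m (fst (induced a n' \<rho>') x)"
    using PQ(3,4) by (simp add: induced_dim)
  then show ?thesis
    using induced_morphism[OF a \<rho> \<rho>' PQ(1) intw]
      induced_morphism[OF a \<rho>' \<rho> PQ(2) tw_intertwiner_inverse[OF \<rho> \<rho>' PQ intw]]
    unfolding eq_isomorphic_def by blast
qed

lemma induced_isomorphic_orbit:
  assumes a: "a \<in> carrier X" and n: "n \<noteq> 0"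
    and iso: "eq_isomorphic G X act (induced a n \<rho>) (induced a' n' \<rho>')"
  shows "a \<in> orbit a'"
proof (rule ccontr)
  assume "a \<notin> orbit a'"
  then have "fst (induced a' n' \<rho>') a = 0" by (simp add: induced_dim)
  moreover obtain f f' where "eq_morphism G X act f (induced a n \<rho>) (induced a' n' \<rho>')"
      "eq_morphism G X act f' (induced a' n' \<rho>') (induced a n \<rho>)"
      "f' a * f a = 1\<^sub>m (fst (induced a n \<rho>) a)"
    using iso a unfolding eq_isomorphic_def by blast
  ultimately show False
    using one_mat_through_dim_0[of "f' a" n "f a"] eq_morphism_carrier a n self_in_orbit[OF a]
    by (metis induced_dim)
qed

lemma induced_isomorphic_tw_isomorphic:
  assumes a: "a \<in> carrier X" and iso: "eq_isomorphic G X act (induced a n \<rho>) (induced a n' \<rho>')"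
  shows "tw_isomorphic (stabilizer G act a) n \<rho> n' \<rho>'"
proof -
  obtain f f' where f: "eq_morphism G X act f (induced a n \<rho>) (induced a n' \<rho>')"
      and f': "eq_morphism G X act f' (induced a n' \<rho>') (induced a n \<rho>)"
      and inv: "f' a * f a = 1\<^sub>m n" "f a * f' a = 1\<^sub>m n'"
    using iso a self_in_orbit[OF a] unfolding eq_isomorphic_def by (fastforce simp: induced_dim)
  have "f a * \<rho> t = \<rho>' t * f a" if t: "t \<in> stabilizer G act a" for t
    using eq_morphism_commute[OF f _ a, of t] t stabilizer_iff induced_action_stabilizer[OF a t]
    by metis
  then show ?thesis
    unfolding tw_isomorphic_def
    using eq_morphism_carrier[OF f a] eq_morphism_carrier[OF f' a] inv self_in_orbit[OF a]
    by (intro exI[of _ "f a"] exI[of _ "f' a"]) (simp add: induced_dim)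
qed

section \<open>Restriction to a stabilizer\<close>

lemma eq_object_one:
  assumes V: "eq_object G X act \<gamma> V" and x: "x \<in> carrier X"
  shows "snd V \<one> x = 1\<^sub>m (fst V x)"
proof -
  obtain v where v: "v \<in> carrier_mat (fst V x) (fst V x)" "v * snd V \<one> x = 1\<^sub>m (fst V x)"
    using eq_object_invertible[OF V one_closed x] act_one[OF x] by metis
  have u: "snd V \<one> x \<in> carrier_mat (fst V x) (fst V x)"
    using eq_object_carrier[OF V one_closed x] act_one[OF x] by simp
  note idem = eq_object_mult[OF V one_closed one_closed x,
      unfolded l_one[OF one_closed] act_one[OF x] cocycle_one_left[OF one_closed x] one_smult_mat,
      symmetric]
  have "snd V \<one> x = (v * snd V \<one> x) * snd V \<one> x" using v(2) u by simp
  also have "\<dots> = v * snd V \<one> x" using assoc_mult_mat[OF v(1) u u] idem by simp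
  finally show ?thesis using v(2) by simp
qed

lemma restriction_tw_module:
  assumes V: "eq_object G X act \<gamma> V" and a: "a \<in> carrier X"
  shows "tw_module G (stabilizer G act a) (\<lambda>g h. \<gamma> g h a) (fst V a) (\<lambda>t. snd V t a)"
  unfolding tw_module_def
proof (intro conjI ballI)
  show "snd V t a \<in> carrier_mat (fst V a) (fst V a)" if "t \<in> stabilizer G act a" for t
    using that eq_object_carrier[OF V _ a, of t] by (simp add: stabilizer_iff)
  show "snd V (s \<otimes> t) a = \<gamma> s t a \<cdot>\<^sub>m (snd V s a * snd V t a)"
    if "s \<in> stabilizer G act a" "t \<in> stabilizer G act a" for s t
    using that eq_object_mult[OF V _ _ a, of s t] by (simp add: stabilizer_iff)
qed (rule eq_object_one[OF V a])

text \<open>The matrices \<open>snd V (orbit_rep a x) a\<close> conjugate \<open>V\<close> to the object induced from its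
  restriction to the stabilizer of \<open>a\<close>.\<close>

lemma eq_object_transport:
  assumes V: "eq_object G X act \<gamma> V" and a: "a \<in> carrier X" and g: "g \<in> carrier G"
    and x: "x \<in> orbit a"
  shows "snd V g x * snd V (orbit_rep a x) a =
     ind_factor a g x \<cdot>\<^sub>m (snd V (orbit_rep a (act g x)) a * snd V (stab_part a g x) a)"
proof -
  have gx: "act g x \<in> orbit a" using act_in_orbit_iff[OF a g] x orbit_subset[OF a] by blast
  note rx = orbit_rep[OF a x] and rgx = orbit_rep[OF a gx]
  have h: "stab_part a g x \<in> carrier G" "act (stab_part a g x) a = a"
    using stab_part_in_stabilizer[OF a g x] stabilizer_iff by auto
  have "\<gamma> g (orbit_rep a x) a \<cdot>\<^sub>m (snd V g x * snd V (orbit_rep a x) a) =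
     \<gamma> (orbit_rep a (act g x)) (stab_part a g x) a \<cdot>\<^sub>m
       (snd V (orbit_rep a (act g x)) a * snd V (stab_part a g x) a)"
    using eq_object_mult[OF V g rx(1) a] eq_object_mult[OF V rgx(1) h(1) a]
      orbit_rep_mult_stab_part[OF a g x] rx(2) h(2) by simp
  then have "inverse (\<gamma> g (orbit_rep a x) a) \<cdot>\<^sub>m (\<gamma> g (orbit_rep a x) a \<cdot>\<^sub>m
      (snd V g x * snd V (orbit_rep a x) a)) =
     ind_factor a g x \<cdot>\<^sub>m (snd V (orbit_rep a (act g x)) a * snd V (stab_part a g x) a)"
    by (simp add: smult_smult_mat ind_factor_def field_simps)
  then show ?thesis using cocycle_nonzero[OF g rx(1) a] by (simp add: smult_smult_mat)
qed

lemma orbit_rep_action_carrier: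
  assumes V: "eq_object G X act \<gamma> V" and a: "a \<in> carrier X" and x: "x \<in> orbit a"
  shows "snd V (orbit_rep a x) a \<in> carrier_mat (fst V x) (fst V a)"
  using eq_object_carrier[OF V orbit_rep(1)[OF a x] a] orbit_rep(2)[OF a x] by simp

lemma transported_eq_subobject:
  assumes V: "eq_object G X act \<gamma> V" and a: "a \<in> carrier X" and S: "lin_subspace (fst V a) S"
    and stable: "\<And>t v. t \<in> stabilizer G act a \<Longrightarrow> v \<in> S \<Longrightarrow> snd V t a *\<^sub>v v \<in> S"
  shows "eq_subobject G X act V
    (\<lambda>x. if x \<in> orbit a then (*\<^sub>v) (snd V (orbit_rep a x) a) ` S else {0\<^sub>v (fst V x)})"
  unfolding eq_subobject_def
proof (intro conjI ballI)
  let ?M = "\<lambda>x. snd V (orbit_rep a x) a"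
  show "lin_subspace (fst V x) (if x \<in> orbit a then (*\<^sub>v) (?M x) ` S else {0\<^sub>v (fst V x)})" for x
    using lin_subspace_image[OF orbit_rep_action_carrier[OF V a] S] by (simp add: lin_subspace_zero)
  fix g x w assume g: "g \<in> carrier G" and x: "x \<in> carrier X"
    and w: "w \<in> (if x \<in> orbit a then (*\<^sub>v) (?M x) ` S else {0\<^sub>v (fst V x)})"
  show "snd V g x *\<^sub>v w \<in> (if act g x \<in> orbit a then (*\<^sub>v) (?M (act g x)) ` S else {0\<^sub>v (fst V (act g x))})"
  proof (cases "x \<in> orbit a")
    case True
    then obtain s where s: "s \<in> S" and ws: "w = ?M x *\<^sub>v s" using w by auto
    have sS: "s \<in> carrier_vec (fst V a)" using S s unfolding lin_subspace_def by blast
    have gx: "act g x \<in> orbit a" using act_in_orbit_iff[OF a g x] True by simp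
    have h: "stab_part a g x \<in> stabilizer G act a" by (rule stab_part_in_stabilizer[OF a g True])
    have hM: "snd V (stab_part a g x) a \<in> carrier_mat (fst V a) (fst V a)"
      using eq_object_carrier[OF V _ a, of "stab_part a g x"] h by (simp add: stabilizer_iff)
    note Mx = orbit_rep_action_carrier[OF V a True] and Mgx = orbit_rep_action_carrier[OF V a gx]
    have "snd V g x *\<^sub>v w = (snd V g x * ?M x) *\<^sub>v s"
      using ws eq_object_carrier[OF V g x] Mx sS by simp
    also have "\<dots> = ?M (act g x) *\<^sub>v (ind_factor a g x \<cdot>\<^sub>v (snd V (stab_part a g x) a *\<^sub>v s))"
      using eq_object_transport[OF V a g True] smult_mat_mult_vec[OF mult_carrier_mat[OF Mgx hM] sS]
        mult_mat_vec[OF Mgx mult_mat_vec_carrier[OF hM sS]] Mgx hM sS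
      by simp
    finally show ?thesis
      using gx stable[OF h s] S unfolding lin_subspace_def by auto
  next
    case False
    then show ?thesis
      using w act_in_orbit_iff[OF a g x] mult_mat_vec_zero[OF eq_object_carrier[OF V g x]] by simp
  qed
qed

lemma restriction_irreducible:
  assumes V: "eq_simple G X act \<gamma> V" and a: "a \<in> carrier X" and n: "fst V a \<noteq> 0"
  shows "tw_irreducible G (stabilizer G act a) (\<lambda>g h. \<gamma> g h a) (fst V a) (\<lambda>t. snd V t a)"
  unfolding tw_irreducible_def
proof (intro conjI allI impI n)
  have obj: "eq_object G X act \<gamma> V" using V by (rule eq_simple_object)
  then show "tw_module G (stabilizer G act a) (\<lambda>g h. \<gamma> g h a) (fst V a) (\<lambda>t. snd V t a)"
    by (rule restriction_tw_module[OF _ a])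
  fix S assume S: "lin_subspace (fst V a) S \<and> (\<forall>t\<in>stabilizer G act a. \<forall>v\<in>S. snd V t a *\<^sub>v v \<in> S)"
  then have sub: "lin_subspace (fst V a) S"
    and stable: "\<And>t v. t \<in> stabilizer G act a \<Longrightarrow> v \<in> S \<Longrightarrow> snd V t a *\<^sub>v v \<in> S" by blast+
  define W where "W = (\<lambda>x. if x \<in> orbit a then (*\<^sub>v) (snd V (orbit_rep a x) a) ` S else {0\<^sub>v (fst V x)})"
  have "S \<subseteq> carrier_vec (fst V a)" using sub unfolding lin_subspace_def by blast
  from one_mat_mult_vec_image[OF this] have "W a = S"
    unfolding W_def using self_in_orbit[OF a] by (simp add: orbit_rep_self eq_object_one[OF obj a])
  moreover have "W a = {0\<^sub>v (fst V a)} \<or> W a = carrier_vec (fst V a)"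
    using eq_simple_subobject[OF V transported_eq_subobject[OF obj a sub stable, folded W_def]] a
    by blast
  ultimately show "S = {0\<^sub>v (fst V a)} \<or> S = carrier_vec (fst V a)" by simp
qed

lemma orbit_rep_eq_morphism:
  assumes V: "eq_object G X act \<gamma> V" and a: "a \<in> carrier X"
    and supp: "\<And>x. x \<in> carrier X \<Longrightarrow> x \<notin> orbit a \<Longrightarrow> fst V x = 0"
  shows "eq_morphism G X act (\<lambda>x. if x \<in> orbit a then snd V (orbit_rep a x) a else 1\<^sub>m 0)
    (induced a (fst V a) (\<lambda>t. snd V t a)) V"
  unfolding eq_morphism_def
proof (intro conjI ballI)
  show "(if x \<in> orbit a then snd V (orbit_rep a x) a else 1\<^sub>m 0)
      \<in> carrier_mat (fst V x) (fst (induced a (fst V a) (\<lambda>t. snd V t a)) x)" if "x \<in> carrier X" for x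
    using orbit_rep_action_carrier[OF V a] supp[OF that] by (simp add: induced_dim)
  fix g x assume g: "g \<in> carrier G" and x: "x \<in> carrier X"
  show "(if act g x \<in> orbit a then snd V (orbit_rep a (act g x)) a else 1\<^sub>m 0) *
      snd (induced a (fst V a) (\<lambda>t. snd V t a)) g x =
      snd V g x * (if x \<in> orbit a then snd V (orbit_rep a x) a else 1\<^sub>m 0)"
  proof (cases "x \<in> orbit a")
    case True
    have gx: "act g x \<in> orbit a" using act_in_orbit_iff[OF a g x] True by simp
    have "snd V (stab_part a g x) a \<in> carrier_mat (fst V a) (fst V a)"
      using eq_object_carrier[OF V _ a, of "stab_part a g x"] stab_part_in_stabilizer[OF a g True]
      by (simp add: stabilizer_iff)
    then show ?thesis
      using True gx eq_object_transport[OF V a g True]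
        mult_smult_distrib[OF orbit_rep_action_carrier[OF V a gx]]
      by (simp add: induced_action)
  next
    case False
    then show ?thesis
      using act_in_orbit_iff[OF a g x] supp[OF x] supp[OF act_closed[OF g x]]
        eq_object_carrier[OF V g x]
      by (intro mat_dim_0_unique) (simp_all add: induced_action)
  qed
qed

lemma induced_restriction_isomorphic:
  assumes V: "eq_object G X act \<gamma> V" and a: "a \<in> carrier X"
    and supp: "\<And>x. x \<in> carrier X \<Longrightarrow> x \<notin> orbit a \<Longrightarrow> fst V x = 0"
  shows "eq_isomorphic G X act (induced a (fst V a) (\<lambda>t. snd V t a)) V"
proof (rule eq_isomorphic_if_invertible[OF induced_eq_object[OF a restriction_tw_module[OF V a]] V
      orbit_rep_eq_morphism[OF V a supp]])
  fix x assume x: "x \<in> carrier X"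
  show "\<exists>v. v \<in> carrier_mat (fst (induced a (fst V a) (\<lambda>t. snd V t a)) x) (fst V x) \<and>
      v * (if x \<in> orbit a then snd V (orbit_rep a x) a else 1\<^sub>m 0) = 1\<^sub>m (fst (induced a (fst V a) (\<lambda>t. snd V t a)) x) \<and>
      (if x \<in> orbit a then snd V (orbit_rep a x) a else 1\<^sub>m 0) * v = 1\<^sub>m (fst V x)"
  proof (cases "x \<in> orbit a")
    case True
    then show ?thesis
      using eq_object_invertible[OF V orbit_rep(1)[OF a True] a] orbit_rep(2)[OF a True]
      by (simp add: induced_dim) metis
  next
    case False
    then show ?thesis using supp[OF x] by (intro exI[of _ "1\<^sub>m 0"]) (simp add: induced_dim)
  qed
qed

lemma eq_simple_isomorphic_induced:
  assumes V: "eq_simple G X act \<gamma> V" and R: "R \<subseteq> carrier X"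
    and cover: "\<forall>x\<in>carrier X. \<exists>a\<in>R. \<exists>g\<in>carrier G. act g a = x"
  shows "\<exists>a\<in>R. \<exists>n \<rho>. tw_irreducible G (stabilizer G act a) (\<lambda>g h. \<gamma> g h a) n \<rho> \<and>
     eq_isomorphic G X act (induced a n \<rho>) V"
proof -
  have obj: "eq_object G X act \<gamma> V" using V by (rule eq_simple_object)
  obtain x0 where x0: "x0 \<in> carrier X" "fst V x0 \<noteq> 0" using V unfolding eq_simple_def by blast
  then obtain a g where ag: "a \<in> R" "g \<in> carrier G" "act g a = x0" using cover by blast
  have a: "a \<in> carrier X" using ag(1) R by blast
  have "x0 \<in> orbit a" using ag unfolding orbit_def by blast
  then have supp: "\<And>x. x \<in> carrier X \<Longrightarrow> x \<notin> orbit a \<Longrightarrow> fst V x = 0"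
    using eq_simple_orbit_support[OF V a _ x0(2)] by blast
  have "fst V a \<noteq> 0" using eq_object_dim_zero_act[OF obj ag(2) a] ag(3) x0(2) by blast
  then show ?thesis
    using ag(1) restriction_irreducible[OF V a] induced_restriction_isomorphic[OF obj a supp] by blast
qed

section \<open>Classification of simple objects\<close>

lemma simple_classes_equiv:
  "equiv {V. eq_simple G X act \<gamma> V}
     {(V, W). eq_simple G X act \<gamma> V \<and> eq_simple G X act \<gamma> W \<and> eq_isomorphic G X act V W}"
proof -
  have "equiv {V. eq_simple G X act \<gamma> V}
     {(V, W). V \<in> {V. eq_simple G X act \<gamma> V} \<and> W \<in> {V. eq_simple G X act \<gamma> V} \<and> eq_isomorphic G X act V W}"
    by (rule equiv_on_pred)
      (use eq_isomorphic_refl eq_isomorphic_sym eq_isomorphic_trans in \<open>auto simp: eq_simple_def\<close>)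
  then show ?thesis by simp
qed

lemma induced_isomorphic_iff:
  assumes R: "orbit_representatives G X act R"
    and p: "(a, n, \<rho>) \<in> Gamma_set G act \<gamma> R" and q: "(a', n', \<rho>') \<in> Gamma_set G act \<gamma> R"
  shows "eq_isomorphic G X act (induced a n \<rho>) (induced a' n' \<rho>') \<longleftrightarrow>
    a = a' \<and> tw_isomorphic (stabilizer G act a) n \<rho> n' \<rho>'"
proof
  have a: "a \<in> carrier X" and n: "n \<noteq> 0"
    using p R unfolding Gamma_set_def tw_irreducible_def orbit_representatives_def by auto
  assume iso: "eq_isomorphic G X act (induced a n \<rho>) (induced a' n' \<rho>')"
  then have "a \<in> orbit a'" by (rule induced_isomorphic_orbit[OF a n])
  then have "a' = a" using R p q unfolding orbit_representatives_def orbit_def Gamma_set_def by blast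
  with iso show "a = a' \<and> tw_isomorphic (stabilizer G act a) n \<rho> n' \<rho>'"
    using induced_isomorphic_tw_isomorphic[OF a] by blast
next
  assume iso: "a = a' \<and> tw_isomorphic (stabilizer G act a) n \<rho> n' \<rho>'"
  moreover have "a \<in> carrier X" using p R unfolding Gamma_set_def orbit_representatives_def by blast
  ultimately show "eq_isomorphic G X act (induced a n \<rho>) (induced a' n' \<rho>')"
    using induced_isomorphic Gamma_set_tw_module[OF p] Gamma_set_tw_module[OF q] by blast
qed

lemma Gamma_classes_bij_simple_classes:
  assumes R: "orbit_representatives G X act R"
  shows "\<exists>F. bij_betw F (Gamma_classes G act \<gamma> R) (simple_classes G X act \<gamma>)"
proof -
  have RX: "R \<subseteq> carrier X" and cover: "\<forall>x\<in>carrier X. \<exists>a\<in>R. \<exists>g\<in>carrier G. act g a = x"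
    using R unfolding orbit_representatives_def by blast+
  let ?f = "\<lambda>(a, n, \<rho>). induced a n \<rho>"
  let ?S = "{(V, W). eq_simple G X act \<gamma> V \<and> eq_simple G X act \<gamma> W \<and> eq_isomorphic G X act V W}"
  let ?\<Gamma> = "{((a, n, \<rho>), (a', n', \<rho>')).
        (a, n, \<rho>) \<in> Gamma_set G act \<gamma> R \<and> (a', n', \<rho>') \<in> Gamma_set G act \<gamma> R \<and>
        a = a' \<and> tw_isomorphic (stabilizer G act a) n \<rho> n' \<rho>'}"
  have simple: "eq_simple G X act \<gamma> (induced a n \<rho>)" if "(a, n, \<rho>) \<in> Gamma_set G act \<gamma> R" for a n \<rho>
    using that RX induced_simple unfolding Gamma_set_def by blast
  have "bij_betw (\<lambda>C. ?S `` (?f ` C)) (Gamma_set G act \<gamma> R // ?\<Gamma>) ({V. eq_simple G X act \<gamma> V} // ?S)"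
  proof (rule bij_betw_quotients[OF Gamma_classes_equiv simple_classes_equiv])
    show "?f p \<in> {V. eq_simple G X act \<gamma> V}" if "p \<in> Gamma_set G act \<gamma> R" for p
      using that simple by (cases p) auto
    show "(?f p, ?f q) \<in> ?S \<longleftrightarrow> (p, q) \<in> ?\<Gamma>"
      if "p \<in> Gamma_set G act \<gamma> R" and "q \<in> Gamma_set G act \<gamma> R" for p q
      using that simple induced_isomorphic_iff[OF R] by (cases p, cases q) simp
    show "\<exists>p\<in>Gamma_set G act \<gamma> R. (?f p, V) \<in> ?S" if V: "V \<in> {V. eq_simple G X act \<gamma> V}" for V
    proof -
      obtain a n \<rho> where "a \<in> R" "tw_irreducible G (stabilizer G act a) (\<lambda>g h. \<gamma> g h a) n \<rho>"
        and iso: "eq_isomorphic G X act (induced a n \<rho>) V"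
        using eq_simple_isomorphic_induced[OF _ RX cover] V by blast
      then have "(a, n, \<rho>) \<in> Gamma_set G act \<gamma> R" unfolding Gamma_set_def by blast
      then show ?thesis using iso simple V by (intro bexI[of _ "(a, n, \<rho>)"]) auto
    qed
  qed
  then show ?thesis unfolding Gamma_classes_def simple_classes_def by blast
qed

end

lemma twisted_action_of_quasi_abelian_3cocycle:
  assumes "crossed_module G X act bd" and "quasi_abelian_3cocycle G X act bd \<omega> \<gamma> \<mu> c"
    and "normalized_cocycle G X \<omega> \<gamma> \<mu> c"
  shows "twisted_action G X act \<gamma>"
proof (intro twisted_action.intro carrier_action.intro carrier_action_axioms.intro
    twisted_action_axioms.intro)
  have G: "group G"
    using assms(1) unfolding crossed_module_def by (elim conjE)
  have hom: "\<forall>g\<in>carrier G. act g \<in> hom X X \<and> bij_betw (act g) (carrier X) (carrier X)"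
    using assms(1) unfolding crossed_module_def by (elim conjE)
  have one: "\<forall>x\<in>carrier X. act \<one>\<^bsub>G\<^esub> x = x"
    using assms(1) unfolding crossed_module_def by (elim conjE)
  have mult: "\<forall>g\<in>carrier G. \<forall>h\<in>carrier G. \<forall>x\<in>carrier X. act (g \<otimes>\<^bsub>G\<^esub> h) x = act g (act h x)"
    using assms(1) unfolding crossed_module_def by (elim conjE)
  have nonzero: "\<forall>g\<in>carrier G. \<forall>h\<in>carrier G. \<forall>x\<in>carrier X. \<gamma> g h x \<noteq> 0"
    using assms(2) unfolding quasi_abelian_3cocycle_def Let_def by (elim conjE)
  have cocycle: "\<forall>g\<in>carrier G. \<forall>h\<in>carrier G. \<forall>k\<in>carrier G. \<forall>x\<in>carrier X.
      \<gamma> h k x * \<gamma> g (h \<otimes>\<^bsub>G\<^esub> k) x = \<gamma> (g \<otimes>\<^bsub>G\<^esub> h) k x * \<gamma> g h (act k x)"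
    using assms(2) unfolding quasi_abelian_3cocycle_def Let_def by (elim conjE)
  have normalized: "\<forall>g\<in>carrier G. \<forall>h\<in>carrier G. \<forall>x\<in>carrier X.
      (g = \<one>\<^bsub>G\<^esub> \<or> h = \<one>\<^bsub>G\<^esub> \<or> x = \<one>\<^bsub>X\<^esub>) \<longrightarrow> \<gamma> g h x = 1"
    using assms(3) unfolding normalized_cocycle_def by (elim conjE)
  show "group G" by (rule G)
  show "act g x \<in> carrier X" if "g \<in> carrier G" "x \<in> carrier X" for g x
    using hom that by (blast intro: hom_in_carrier)
  show "act \<one>\<^bsub>G\<^esub> x = x" if "x \<in> carrier X" for x
    using one that by blast
  show "act (g \<otimes>\<^bsub>G\<^esub> h) x = act g (act h x)" if "g \<in> carrier G" "h \<in> carrier G" "x \<in> carrier X"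
    for g h x
    using mult that by blast
  show "\<gamma> g h x \<noteq> 0" if "g \<in> carrier G" "h \<in> carrier G" "x \<in> carrier X" for g h x
    using nonzero that by blast
  show "\<gamma> h k x * \<gamma> g (h \<otimes>\<^bsub>G\<^esub> k) x = \<gamma> (g \<otimes>\<^bsub>G\<^esub> h) k x * \<gamma> g h (act k x)"
    if "g \<in> carrier G" "h \<in> carrier G" "k \<in> carrier G" "x \<in> carrier X" for g h k x
    using cocycle that by blast
  show "\<gamma> \<one>\<^bsub>G\<^esub> h x = 1" "\<gamma> h \<one>\<^bsub>G\<^esub> x = 1" if "h \<in> carrier G" "x \<in> carrier X" for h x
    using normalized that monoid.one_closed[OF group.is_monoid[OF G]] by blast+
qed

theorem proposition5p5:
  fixes G :: "('g, 'a) monoid_scheme" and X :: "('x, 'b) monoid_scheme"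
    and act :: "'g \<Rightarrow> 'x \<Rightarrow> 'x" and bd :: "'x \<Rightarrow> 'g"
    and \<omega> :: "'x \<Rightarrow> 'x \<Rightarrow> 'x \<Rightarrow> 'k::field_char_0" and \<gamma> :: "'g \<Rightarrow> 'g \<Rightarrow> 'x \<Rightarrow> 'k"
    and \<mu> :: "'g \<Rightarrow> 'x \<Rightarrow> 'x \<Rightarrow> 'k" and c :: "'x \<Rightarrow> 'x \<Rightarrow> 'k"
    and R :: "'x set"
  assumes "alg_closed TYPE('k)"
    and "crossed_module G X act bd"
    and "quasi_abelian_3cocycle G X act bd \<omega> \<gamma> \<mu> c"
    and "normalized_cocycle G X \<omega> \<gamma> \<mu> c"
    and "orbit_representatives G X act R"
  shows "\<exists>F. bij_betw F (simple_classes G X act \<gamma>) (Gamma_classes G act \<gamma> R)"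
proof -
  interpret twisted_action G X act \<gamma>
    using twisted_action_of_quasi_abelian_3cocycle assms(2-4) .
  obtain F where "bij_betw F (Gamma_classes G act \<gamma> R) (simple_classes G X act \<gamma>)"
    using Gamma_classes_bij_simple_classes[OF assms(5)] by blast
  then show ?thesis by (rule bij_betw_inv)
qed

end
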